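(* Let $A\in S_+(\mathbb{R}^n)$ and let $\hat A$ be a random matrix with $\hat A\in S_+(\mathbb{R}^n)$ almost surely, $\mathbb{E}[\hat A]\preceq A$ (in particular this covers $\mathbb{E}[\hat A]=A$), and $\mathbb{E}[\hat A^{-2}]$ finite. Suppose that for some $\varepsilon>0$, $0\prec\hat A\prec(2-\varepsilon)A$ almost surely. Let $R\in\mathbb{R}^{n\times n}$ be a nonzero symmetric positive semi-definite matrix, and let $\beta^*=\operatorname{arg\,min}_{\beta\in\mathbb{R}}\mathcal{E}_{A,R}(\hat A^{-1}-\beta\hat K)$ with $\hat K=\hat A^{-1}$. Put $$\hat Z=\hat A-A,\qquad \hat X=-A^{-1/2}\hat Z A^{-1/2},\qquad S=A^{-1/2}RA^{-1/2},$$ and for integers $N\ge 1$ define $$\beta_N=\frac{\sum_{k=0}^{2N}\omega^N(k)\,\langle\hat X^k\rangle_S}{\sum_{k=0}^{2N}\omega^N_*(k)\,\langle\hat X^k\rangle_S}=\frac{\mathbb{E}\left[\sum_{k=0}^{2N}\omega^N(k)\,(-1)^k\,\hat q^TA^{-1}(\hat ZA^{-1})^k\hat q\right]}{\mathbb{E}\left[\sum_{k=0}^{2N}\omega^N_*(k)\,(-1)^k\,\hat q^TA^{-1}(\hat ZA^{-1})^k\hat q\right]},$$ where $\hat q$ is a random vector independent of $\hat A$ with $\mathbb{E}[\hat q\hat q^T]=R$, and $$\omega^N(k)=\begin{cases}k & k<2N\\ \frac{k-1}{2} & k=2N\\ 0&\text{otherwise}\end{cases},\qquad \omega^N_*(k)=\begin{cases}k+1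 & k<2N\\ \frac{k}{2} & k=2N\\ 0&\text{otherwise.}\end{cases}$$ Then $\beta_N\nearrow\beta^*$ as $N\to\infty$, $$0\le\beta_1\le\beta_2\le\cdots\le\beta_N\le\cdots\le\beta^*\le 1,$$ and $$\mathcal{E}_{A,R}(\hat A^{-1})\ge\mathcal{E}_{A,R}((1-\beta_1)\hat A^{-1})\ge\cdots\ge\mathcal{E}_{A,R}((1-\beta_N)\hat A^{-1})\ge\cdots\ge\mathcal{E}_{A,R}((1-\beta^* )\hat A^{-1}).$$
   Context: $S_+(\mathbb{R}^n)$ is the set of symmetric positive definite $n\times n$ real matrices; $\preceq,\prec$ denote the Loewner order. For symmetric positive semi-definite $P,Q$ and $X\in\mathbb{R}^{n\times n}$, $\|X\|_{P,Q}^2=\operatorname{tr}(Q^{1/2}X^TPXQ^{1/2})$, and for a random matrix $\hat Y$ regarded as an estimator of $A^{-1}$, $\mathcal{E}_{P,Q}(\hat Y)=\mathbb{E}\|\hat Y-A^{-1}\|_{P,Q}^2$. For a symmetric positive semi-definite matrix $S$ and a random matrix $\hat Y$, $\langle\hat Y\rangle_S=\mathbb{E}\operatorname{tr}(S^{1/2}\hat YS^{1/2})$. The notation $\beta_N\nearrow\beta^*$ means monotone (non-decreasing) convergence. *)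

theory Defs
  imports "HOL-Probability.Probability"
begin

definition pos_semidef :: "real^'n^'n \<Rightarrow> bool" where
  "pos_semidef P \<longleftrightarrow> transpose P = P \<and> (\<forall>x. 0 \<le> x \<bullet> (P *v x))"

definition pos_def :: "real^'n^'n \<Rightarrow> bool" where
  "pos_def P \<longleftrightarrow> transpose P = P \<and> (\<forall>x. x \<noteq> 0 \<longrightarrow> 0 < x \<bullet> (P *v x))"

definition loewner_le :: "real^'n^'n \<Rightarrow> real^'n^'n \<Rightarrow> bool" (infix \<open>\<preceq>\<close> 50) where
  "P \<preceq> Q \<longleftrightarrow> pos_semidef (Q - P)"

definition loewner_less :: "real^'n^'n \<Rightarrow> real^'n^'n \<Rightarrow> bool" (infix \<open>\<prec>\<close> 50) where
  "P \<prec> Q \<longleftrightarrow> pos_def (Q - P)"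

(* The principal square root, which exists and is unique exactly when P is
   symmetric positive semidefinite; for other arguments the value is unspecified. *)
definition mat_sqrt :: "real^'n^'n \<Rightarrow> real^'n^'n" where
  "mat_sqrt P = (THE Q. pos_semidef Q \<and> Q ** Q = P)"

(* The library's multiplication and power on real^'n^'n act entrywise,
   so powers with respect to the matrix product are defined separately. *)
primrec mat_power :: "real^'n^'n \<Rightarrow> nat \<Rightarrow> real^'n^'n" where
  "mat_power X 0 = mat 1"
| "mat_power X (Suc k) = X ** mat_power X k"

definition wnorm_sq :: "real^'n^'n \<Rightarrow> real^'n^'n \<Rightarrow> real^'n^'n \<Rightarrow> real" where
  "wnorm_sq P Q X = trace (mat_sqrt Q ** transpose X ** P ** X ** mat_sqrt Q)"

(* The error of the random matrix Y, on the probability space M, as an estimator of the inverse of A. *)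
definition inv_error ::
  "'w measure \<Rightarrow> real^'n^'n \<Rightarrow> real^'n^'n \<Rightarrow> real^'n^'n \<Rightarrow> ('w \<Rightarrow> real^'n^'n) \<Rightarrow> real" where
  "inv_error M A P Q Y = (\<integral>\<omega>. wnorm_sq P Q (Y \<omega> - matrix_inv A) \<partial>M)"

definition exp_trace :: "'w measure \<Rightarrow> real^'n^'n \<Rightarrow> ('w \<Rightarrow> real^'n^'n) \<Rightarrow> real" where
  "exp_trace M S Y = (\<integral>\<omega>. trace (mat_sqrt S ** Y \<omega> ** mat_sqrt S) \<partial>M)"

definition weight_num :: "nat \<Rightarrow> nat \<Rightarrow> real" where
  "weight_num N k = (if k < 2 * N then real k else if k = 2 * N then (real k - 1) / 2 else 0)"

definition weight_den :: "nat \<Rightarrow> nat \<Rightarrow> real" where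
  "weight_den N k = (if k < 2 * N then real k + 1 else if k = 2 * N then real k / 2 else 0)"

(* Independence of random variables with values in possibly different types,
   which indep_var does not allow: the generated sigma-algebras are independent. *)
definition indep_rv :: "'w measure \<Rightarrow> ('w \<Rightarrow> 'a::topological_space) \<Rightarrow> ('w \<Rightarrow> 'b::topological_space) \<Rightarrow> bool" where
  "indep_rv M X Y \<longleftrightarrow>
     prob_space.indep_set M (sets (vimage_algebra (space M) X borel))
                            (sets (vimage_algebra (space M) Y borel))"

definition inv_sqrt :: "real^'n^'n \<Rightarrow> real^'n^'n" where
  "inv_sqrt A = matrix_inv (mat_sqrt A)"

(* The matrices X and S of the expansion; Y stands for a value of the random matrix Ahat,
   and Y - A for the corresponding value of Zhat. *)
definition rel_dev :: "real^'n^'n \<Rightarrow> real^'n^'n \<Rightarrow> real^'n^'n" where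
  "rel_dev A Y = - (inv_sqrt A ** (Y - A) ** inv_sqrt A)"

definition conj_weight :: "real^'n^'n \<Rightarrow> real^'n^'n \<Rightarrow> real^'n^'n" where
  "conj_weight A R = inv_sqrt A ** R ** inv_sqrt A"

definition beta_seq ::
  "'w measure \<Rightarrow> real^'n^'n \<Rightarrow> real^'n^'n \<Rightarrow> ('w \<Rightarrow> real^'n^'n) \<Rightarrow> nat \<Rightarrow> real" where
  "beta_seq M A R Ahat N =
     (\<Sum>k\<le>2*N. weight_num N k * exp_trace M (conj_weight A R) (\<lambda>\<omega>. mat_power (rel_dev A (Ahat \<omega>)) k)) /
     (\<Sum>k\<le>2*N. weight_den N k * exp_trace M (conj_weight A R) (\<lambda>\<omega>. mat_power (rel_dev A (Ahat \<omega>)) k))"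

(* The minimiser of b -> error of (Ahat^-1 - b Khat), with weights A and R. *)
definition beta_opt ::
  "'w measure \<Rightarrow> real^'n^'n \<Rightarrow> real^'n^'n \<Rightarrow> ('w \<Rightarrow> real^'n^'n) \<Rightarrow> ('w \<Rightarrow> real^'n^'n) \<Rightarrow> real" where
  "beta_opt M A R Ahat Khat =
     arg_min_on (\<lambda>b. inv_error M A A R (\<lambda>\<omega>. matrix_inv (Ahat \<omega>) - b *\<^sub>R Khat \<omega>)) UNIV"

end

theory Submission
  imports Defs
begin

text \<open>In an orthonormal eigenbasis of the symmetric matrix \<open>X\<close>, every trace \<open>tr (S f(X))\<close> is the
  integral of \<open>f\<close> against a discrete nonnegative measure on \<open>(\<epsilon> - 1, 1)\<close>. Since
  \<open>sum (k+1) x^k = 1/(1-x)^2\<close> and \<open>sum k x^k = x/(1-x)^2\<close>, the truncated denominators and numerators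
  of \<open>\<beta>\<close> converge to \<open>a = E tr (S (1-X)^-2)\<close> and \<open>a - b\<close> with \<open>b = E tr (S (1-X)^-1)\<close>, by
  dominated convergence. The error of the estimator scaled by \<open>c\<close> is \<open>c^2 a - 2 c b + const\<close>, so its
  optimal \<open>\<beta>\<close> is \<open>1 - b/a\<close> and it decreases up to there. The weights of the last term are
  chosen so that passing from \<open>N\<close> to \<open>N+1\<close> adds \<open>(N+1) d\<close> to the denominator and \<open>(2N+1)/2 d\<close> to the numerator with
  the same \<open>d = E tr (S X^(2N) (1+X)^2) \<ge> 0\<close>; the mediant inequality then gives monotonicity.\<close>

section \<open>Spectral decomposition of symmetric matrices\<close>

lemma symmetric_dot_swap:
  fixes A :: "real^'n^'n"
  assumes "transpose A = A"
  shows "x \<bullet> (A *v y) = y \<bullet> (A *v x)"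
  by (metis assms dot_lmul_matrix inner_commute transpose_matrix_vector)

text \<open>A maximiser \<open>v\<close> of the quadratic form on the unit sphere, with value \<open>c\<close>, is an eigenvector:
  the form \<open>c |x|^2 - x \<bullet> A x\<close> is nonnegative and vanishes at \<open>v\<close>, so its derivative
  at \<open>v\<close> vanishes.\<close>

lemma symmetric_has_eigenvector:
  fixes A :: "real^'n^'n"
  assumes sym: "transpose A = A" and V: "subspace V"
    and inv: "\<And>x. x \<in> V \<Longrightarrow> A *v x \<in> V" and ne: "\<exists>x\<in>V. x \<noteq> 0"
  shows "\<exists>v\<in>V. norm v = 1 \<and> (\<exists>c. A *v v = c *\<^sub>R v)"
proof -
  let ?S = "sphere 0 1 \<inter> V"
  obtain x where x: "x \<in> V" "x \<noteq> 0" using ne by blast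
  have "(1 / norm x) *\<^sub>R x \<in> ?S"
    using x V by (auto simp: subspace_scale)
  then have Sne: "?S \<noteq> {}" by blast
  have comp: "compact ?S"
    by (intro compact_Int_closed compact_sphere closed_subspace V)
  have cont: "continuous_on ?S (\<lambda>x. x \<bullet> (A *v x))"
    by (intro continuous_on_inner continuous_on_id matrix_vector_mult_linear_continuous_on)
  obtain v where v: "v \<in> ?S" and vmax: "\<And>y. y \<in> ?S \<Longrightarrow> y \<bullet> (A *v y) \<le> v \<bullet> (A *v v)"
    using continuous_attains_sup[OF comp Sne cont] by blast
  define c where "c = v \<bullet> (A *v v)"
  define g where "g y = c * (y \<bullet> y) - y \<bullet> (A *v y)" for y
  have g_nonneg: "0 \<le> g y" if "y \<in> V" for y
  proof (cases "y = 0")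
    case False
    have "(1 / norm y) *\<^sub>R y \<in> ?S" using False that V by (auto simp: subspace_scale)
    from vmax[OF this] have "(y \<bullet> (A *v y)) / (norm y)^2 \<le> c"
      by (simp add: c_def matrix_vector_mult_scaleR power2_eq_square)
    then have "y \<bullet> (A *v y) \<le> c * (norm y)^2" using False by (simp add: pos_divide_le_eq)
    then show ?thesis by (simp add: g_def power2_norm_eq_inner)
  qed (simp add: g_def)
  define u where "u = c *\<^sub>R v - A *v v"
  have uV: "u \<in> V" and vV: "v \<in> V"
    using v inv V by (auto simp: u_def subspace_diff subspace_scale)
  have vv: "v \<bullet> v = 1" using v by (simp add: norm_eq_1)
  have uu: "u \<bullet> u = c * (v \<bullet> u) - u \<bullet> (A *v v)"
    by (simp add: u_def inner_diff_left inner_diff_right inner_commute algebra_simps)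
  have expand: "g (v + t *\<^sub>R u) = 2 * t * (u \<bullet> u) + t^2 * g u" for t
  proof -
    have "v \<bullet> (A *v u) = u \<bullet> (A *v v)" by (rule symmetric_dot_swap[OF sym])
    then have "(v + t *\<^sub>R u) \<bullet> (A *v (v + t *\<^sub>R u)) = c + 2 * t * (u \<bullet> (A *v v)) + t^2 * (u \<bullet> (A *v u))"
      by (simp add: matrix_vector_right_distrib matrix_vector_mult_scaleR inner_add_left
          inner_add_right c_def power2_eq_square distrib_left)
    moreover have "(v + t *\<^sub>R u) \<bullet> (v + t *\<^sub>R u) = 1 + 2 * t * (v \<bullet> u) + t^2 * (u \<bullet> u)"
      by (simp add: inner_add_left inner_add_right vv inner_commute[of u v] power2_eq_square distrib_left)
    ultimately have "g (v + t *\<^sub>R u) = 2 * t * (c * (v \<bullet> u) - u \<bullet> (A *v v)) + t^2 * g u"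
      unfolding g_def by (simp add: algebra_simps)
    then show ?thesis by (simp add: uu)
  qed
  have "u \<bullet> u = 0"
  proof (rule ccontr)
    assume "u \<bullet> u \<noteq> 0"
    then have pos: "0 < u \<bullet> u" by simp
    \<comment> \<open>The minimiser of \<open>2 * t * (u \<bullet> u) + t^2 * g u\<close> would be
      \<open>- (u \<bullet> u) / g u\<close>; the added 1 avoids a zero denominator and still gives
      a negative value.\<close>
    define t where "t = - (u \<bullet> u) / (g u + 1)"
    have gu: "0 \<le> g u" by (rule g_nonneg[OF uV])
    have "0 \<le> g (v + t *\<^sub>R u)" by (intro g_nonneg subspace_add subspace_scale V vV uV)
    also have "\<dots> = (u \<bullet> u)^2 / (g u + 1) * (g u / (g u + 1) - 2)"
      unfolding expand t_def using gu by (simp add: divide_simps) (simp add: algebra_simps power2_eq_square)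
    also have "\<dots> < 0"
      using pos gu by (intro mult_pos_neg) (auto simp: divide_simps)
    finally show False by simp
  qed
  then have "A *v v = c *\<^sub>R v" by (simp add: u_def)
  then show ?thesis using v by auto
qed

text \<open>The basis is a set that indexes itself, so \<open>l\<close> is a function of the basis
  vector instead of a family over \<open>'n\<close>.\<close>

definition eigenbasis :: "real^'n^'n \<Rightarrow> (real^'n) set \<Rightarrow> (real^'n \<Rightarrow> real) \<Rightarrow> bool" where
  "eigenbasis A B l \<longleftrightarrow> finite B \<and> pairwise orthogonal B \<and> span B = UNIV \<and>
     (\<forall>b\<in>B. norm b = 1 \<and> A *v b = l b *\<^sub>R b)"

text \<open>Orthonormal sets of eigenvectors are independent, so one of largest cardinality exists.
  Its orthogonal complement is invariant under \<open>A\<close>; were it nonzero, it would contain a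
  further eigenvector.\<close>

lemma symmetric_has_eigenbasis:
  fixes A :: "real^'n^'n"
  assumes sym: "transpose A = A"
  shows "\<exists>B l. eigenbasis A B l"
proof -
  define P where "P B \<longleftrightarrow> pairwise orthogonal B \<and> (\<forall>b\<in>B. norm b = 1 \<and> (\<exists>c. A *v b = c *\<^sub>R b))"
    for B :: "(real^'n) set"
  have ind: "independent B" if "P B" for B
    using that by (intro pairwise_orthogonal_independent) (auto simp: P_def)
  have bound: "finite B \<and> card B \<le> CARD('n)" if "P B" for B
    using independent_bound[OF ind[OF that]] by simp
  have "P {}" by (simp add: P_def pairwise_def)
  then have "\<exists>B. P B \<and> (\<forall>C. P C \<longrightarrow> card C \<le> card B)"
    by (rule ex_has_greatest_nat[where b="Suc CARD('n)"])
       (simp add: bound less_Suc_eq_le)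
  then obtain B where B: "P B" and Bmax: "\<And>C. P C \<Longrightarrow> card C \<le> card B"
    by blast
  have "span B = UNIV"
  proof (rule ccontr)
    assume "span B \<noteq> UNIV"
    then obtain a where a: "a \<noteq> 0" "\<And>x. x \<in> span B \<Longrightarrow> a \<bullet> x = 0"
      using span_not_UNIV_orthogonal by blast
    define V where "V = {x. \<forall>b\<in>B. b \<bullet> x = 0}"
    have sub: "subspace V" by (auto simp: V_def subspace_def inner_add_right)
    have inv: "A *v x \<in> V" if "x \<in> V" for x
    proof -
      have "b \<bullet> (A *v x) = 0" if "b \<in> B" for b
      proof -
        obtain c where "A *v b = c *\<^sub>R b" using B \<open>b \<in> B\<close> by (auto simp: P_def)
        then have "b \<bullet> (A *v x) = c * (b \<bullet> x)"
          using symmetric_dot_swap[OF sym, of b x] by (simp add: inner_commute)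
        then show ?thesis using \<open>x \<in> V\<close> \<open>b \<in> B\<close> by (simp add: V_def)
      qed
      then show ?thesis by (simp add: V_def)
    qed
    have "a \<in> V" using a by (auto simp: V_def inner_commute span_base)
    with symmetric_has_eigenvector[OF sym sub inv] a
    obtain v c where v: "v \<in> V" "norm v = 1" "A *v v = c *\<^sub>R v" by metis
    have "v \<notin> B" using v by (auto simp: V_def)
    have "P (insert v B)"
      using B v by (auto simp: P_def pairwise_insert V_def orthogonal_def inner_commute)
    from Bmax[OF this] \<open>v \<notin> B\<close> bound[OF B] show False by simp
  qed
  moreover obtain l where "\<forall>b\<in>B. A *v b = l b *\<^sub>R b"
    using bchoice[of B "\<lambda>b c. A *v b = c *\<^sub>R b"] B by (auto simp: P_def)
  ultimately have "eigenbasis A B l" using B bound[OF B] by (simp add: P_def eigenbasis_def)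
  then show ?thesis by blast
qed

lemma pos_semidef_has_eigenbasis:
  assumes "pos_semidef P"
  obtains B l where "eigenbasis P B l"
  using symmetric_has_eigenbasis assms unfolding pos_semidef_def by blast

lemma eigenbasis_card:
  assumes "eigenbasis (A :: real^'n^'n) B l"
  shows "card B \<le> CARD('n)"
proof -
  have "independent B"
    using assms by (intro pairwise_orthogonal_independent) (auto simp: eigenbasis_def)
  from independent_bound[OF this] show ?thesis by simp
qed

lemma eigenbasis_expand:
  assumes "eigenbasis A B l"
  shows "(\<Sum>b\<in>B. (x \<bullet> b) *\<^sub>R b) = x"
  using assms by (intro orthonormal_basis_expand) (auto simp: eigenbasis_def)

lemma eigenbasis_mult_expand:
  assumes "eigenbasis A B l"
  shows "A *v x = (\<Sum>b\<in>B. (l b * (x \<bullet> b)) *\<^sub>R b)"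
proof -
  have "A *v x = A *v (\<Sum>b\<in>B. (x \<bullet> b) *\<^sub>R b)" by (simp add: eigenbasis_expand[OF assms])
  also have "\<dots> = (\<Sum>b\<in>B. (x \<bullet> b) *\<^sub>R (A *v b))"
    using assms by (subst linear_sum) (auto simp: eigenbasis_def matrix_vector_mult_scaleR)
  also have "\<dots> = (\<Sum>b\<in>B. (l b * (x \<bullet> b)) *\<^sub>R b)"
    using assms by (intro sum.cong) (auto simp: eigenbasis_def mult.commute)
  finally show ?thesis .
qed

lemma matrix_nth_eq_dot: "(C :: real^'n^'m) $ i $ j = axis i 1 \<bullet> (C *v axis j 1)"
  by (simp add: inner_axis' matrix_vector_mult_basis column_def)

text \<open>Each diagonal entry is expanded in \<open>B\<close>; after exchanging the sums, the sum
  over coordinates is again an inner product.\<close>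

lemma trace_eigenbasis:
  assumes B: "eigenbasis A B l"
  shows "trace C = (\<Sum>b\<in>B. b \<bullet> (C *v b))"
proof -
  have "trace C = (\<Sum>i\<in>UNIV. \<Sum>b\<in>B. (axis i 1 \<bullet> b) * (axis i 1 \<bullet> (C *v b)))"
    unfolding trace_def
  proof (intro sum.cong refl)
    fix i :: 'a
    have "C $ i $ i = axis i 1 \<bullet> (C *v (\<Sum>b\<in>B. (axis i 1 \<bullet> b) *\<^sub>R b))"
      by (simp add: eigenbasis_expand[OF B] matrix_nth_eq_dot)
    also have "\<dots> = axis i 1 \<bullet> (\<Sum>b\<in>B. (axis i 1 \<bullet> b) *\<^sub>R (C *v b))"
      using B by (subst linear_sum) (auto simp: eigenbasis_def matrix_vector_mult_scaleR)
    finally show "C $ i $ i = (\<Sum>b\<in>B. (axis i 1 \<bullet> b) * (axis i 1 \<bullet> (C *v b)))"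
      by (simp add: inner_sum_right)
  qed
  also have "\<dots> = (\<Sum>b\<in>B. \<Sum>i\<in>UNIV. (axis i 1 \<bullet> b) * (axis i 1 \<bullet> (C *v b)))"
    by (rule sum.swap)
  also have "\<dots> = (\<Sum>b\<in>B. b \<bullet> (C *v b))"
    by (simp add: inner_axis') (simp add: inner_vec_def)
  finally show ?thesis .
qed

lemma mat_power_eigenvector:
  assumes "A *v b = l *\<^sub>R b"
  shows "mat_power A k *v b = l ^ k *\<^sub>R b"
  by (induction k)
     (simp_all add: assms matrix_vector_mul_assoc[symmetric] matrix_vector_mult_scaleR)

lemma eigenbasis_mat_power:
  assumes "eigenbasis A B l"
  shows "eigenbasis (mat_power A k) B (\<lambda>b. l b ^ k)"
  using assms by (auto simp: eigenbasis_def mat_power_eigenvector)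

text \<open>Each of the at most \<open>CARD('n)\<close> terms of the spectral expansion has modulus
  at most 1. The crude bound matters because it is the same for all powers of such a matrix, which
  makes them integrable.\<close>

lemma eigenbasis_nth_bound:
  assumes B: "eigenbasis (A :: real^'n^'n) B l" and l: "\<And>b. b \<in> B \<Longrightarrow> \<bar>l b\<bar> \<le> 1"
  shows "\<bar>A $ i $ j\<bar> \<le> CARD('n)"
proof -
  have "A $ i $ j = (\<Sum>b\<in>B. l b * (axis j 1 \<bullet> b) * (axis i 1 \<bullet> b))"
    unfolding matrix_nth_eq_dot eigenbasis_mult_expand[OF B, of "axis j 1"] by (simp add: inner_sum_right)
  also have "\<bar>\<dots>\<bar> \<le> (\<Sum>b\<in>B. 1)"
  proof (rule sum_abs[THEN order_trans], rule sum_mono)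
    fix b assume b: "b \<in> B"
    have "\<bar>axis i 1 \<bullet> b\<bar> \<le> 1" for i
      using Cauchy_Schwarz_ineq2[of "axis i 1" b] B b by (simp add: eigenbasis_def)
    with l[OF b] show "\<bar>l b * (axis j 1 \<bullet> b) * (axis i 1 \<bullet> b)\<bar> \<le> 1"
      by (simp add: abs_mult mult_le_one)
  qed
  also have "\<dots> \<le> CARD('n)" using eigenbasis_card[OF B] by simp
  finally show ?thesis .
qed

lemma eigenbasis_nonneg:
  assumes "eigenbasis P B l" "pos_semidef P" "b \<in> B"
  shows "0 \<le> l b"
proof -
  have "b \<bullet> b = 1" "P *v b = l b *\<^sub>R b" using assms by (auto simp: eigenbasis_def norm_eq_1)
  then show ?thesis using assms(2) unfolding pos_semidef_def by (metis inner_scaleR_right mult.right_neutral)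
qed

section \<open>Positive matrices and square roots\<close>

lemma pos_def_imp_semidef: "pos_def P \<Longrightarrow> pos_semidef P"
  unfolding pos_def_def pos_semidef_def by (metis inner_zero_left less_eq_real_def)

text \<open>In an eigenbasis of \<open>Q\<close> the trace is a sum of eigenvalues of
  \<open>Q\<close> times values of the quadratic form of \<open>P\<close>, although
  \<open>P ** Q\<close> itself need not be symmetric.\<close>

lemma trace_mult_nonneg:
  assumes "pos_semidef P" "pos_semidef Q"
  shows "0 \<le> trace (P ** Q)"
proof -
  obtain B l where B: "eigenbasis Q B l"
    using pos_semidef_has_eigenbasis[OF assms(2)] .
  have "b \<bullet> ((P ** Q) *v b) = l b * (b \<bullet> (P *v b))" if "b \<in> B" for b
    using B that by (simp add: eigenbasis_def matrix_vector_mul_assoc[symmetric] matrix_vector_mult_scaleR)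
  then show ?thesis
    unfolding trace_eigenbasis[OF B] using assms eigenbasis_nonneg[OF B assms(2)]
    by (auto intro!: sum_nonneg simp: pos_semidef_def)
qed

lemma trace_mult_pos:
  assumes P: "pos_def P" and Q: "pos_semidef Q" "Q \<noteq> 0"
  shows "0 < trace (P ** Q)"
proof -
  obtain B l where B: "eigenbasis Q B l"
    using pos_semidef_has_eigenbasis[OF Q(1)] .
  have tr: "trace (P ** Q) = (\<Sum>b\<in>B. l b * (b \<bullet> (P *v b)))"
    unfolding trace_eigenbasis[OF B] using B
    by (simp add: eigenbasis_def matrix_vector_mul_assoc[symmetric] matrix_vector_mult_scaleR)
  have pos: "0 < b \<bullet> (P *v b)" if "b \<in> B" for b
  proof -
    have "norm b = 1" using B that by (simp add: eigenbasis_def)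
    then have "b \<noteq> 0" by auto
    with P show ?thesis by (simp add: pos_def_def)
  qed
  have "\<exists>b\<in>B. l b \<noteq> 0"
  proof (rule ccontr)
    assume "\<not> ?thesis"
    then have "Q *v x = 0 *v x" for x unfolding eigenbasis_mult_expand[OF B, of x] by simp
    with Q show False by (metis matrix_eq)
  qed
  then obtain b where b: "b \<in> B" "0 < l b" using eigenbasis_nonneg[OF B Q(1)] by force
  show ?thesis unfolding tr using B b pos eigenbasis_nonneg[OF B Q(1)]
    by (intro sum_pos2[where i=b]) (auto simp: eigenbasis_def less_imp_le)
qed

lemma pos_def_invertible:
  assumes "pos_def (P :: real^'n^'n)"
  shows "invertible P"
proof -
  have "x = 0" if "P *v x = 0" for x
    using assms that unfolding pos_def_def by (metis inner_zero_right less_irrefl)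
  then show ?thesis using invertible_left_inverse matrix_left_invertible_ker by blast
qed

lemma matrix_inv_right: "invertible (A :: real^'n^'n) \<Longrightarrow> A ** matrix_inv A = mat 1"
  and matrix_inv_left: "invertible (A :: real^'n^'n) \<Longrightarrow> matrix_inv A ** A = mat 1"
  unfolding invertible_def matrix_inv_def by (metis (mono_tags, lifting) someI_ex)+

lemma matrix_inv_eqI:
  assumes "(C :: real^'n^'n) ** A = mat 1"
  shows "matrix_inv A = C"
proof -
  have "invertible A" using assms invertible_left_inverse by blast
  then have "matrix_inv A = (C ** A) ** matrix_inv A" by (simp add: assms)
  also have "\<dots> = C" using matrix_inv_right[OF \<open>invertible A\<close>]
    by (simp add: matrix_mul_assoc[symmetric])
  finally show ?thesis .
qed

lemma transpose_matrix_inv: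
  assumes "invertible (A :: real^'n^'n)"
  shows "transpose (matrix_inv A) = matrix_inv (transpose A)"
  by (rule sym, rule matrix_inv_eqI)
     (metis assms matrix_inv_right matrix_transpose_mul transpose_mat)

lemma pos_def_matrix_inv:
  assumes P: "pos_def (P :: real^'n^'n)"
  shows "pos_def (matrix_inv P)"
  unfolding pos_def_def
proof (intro conjI allI impI)
  note inv = pos_def_invertible[OF P]
  show "transpose (matrix_inv P) = matrix_inv P"
    using P by (simp add: transpose_matrix_inv[OF inv] pos_def_def)
  fix x :: "real^'n" assume "x \<noteq> 0"
  define y where "y = matrix_inv P *v x"
  have x: "x = P *v y" by (simp add: y_def matrix_vector_mul_assoc matrix_inv_right[OF inv])
  then have "y \<noteq> 0" using \<open>x \<noteq> 0\<close> by auto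
  then have "0 < y \<bullet> (P *v y)" using P by (simp add: pos_def_def)
  then have "0 < x \<bullet> y" by (simp add: x inner_commute)
  then show "0 < x \<bullet> (matrix_inv P *v x)" by (simp add: y_def)
qed

text \<open>The map \<open>f\<close> keeps the eigenvectors of \<open>P\<close> and replaces the
  eigenvalues by their square roots.\<close>

lemma pos_semidef_sqrt_exists:
  assumes P: "pos_semidef (P :: real^'n^'n)"
  shows "\<exists>Q. pos_semidef Q \<and> Q ** Q = P"
proof -
  obtain B l where B: "eigenbasis P B l"
    using pos_semidef_has_eigenbasis[OF P] .
  define f where "f x = (\<Sum>b\<in>B. (sqrt (l b) * (x \<bullet> b)) *\<^sub>R b)" for x
  define Q where "Q = matrix f"
  have "linear f"
    by (rule linearI) (simp_all add: f_def inner_add_left algebra_simps sum.distrib scaleR_sum_right)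
  then have Qf: "Q *v x = f x" for x by (simp add: Q_def matrix_works)
  have fdot: "y \<bullet> f x = (\<Sum>b\<in>B. sqrt (l b) * (x \<bullet> b) * (y \<bullet> b))" for x y
    by (simp add: f_def inner_sum_right)
  have fb: "f b = sqrt (l b) *\<^sub>R b" if "b \<in> B" for b
  proof -
    have "f b = (\<Sum>c\<in>B. if c = b then sqrt (l b) *\<^sub>R b else 0)"
      unfolding f_def using B that
      by (intro sum.cong refl) (auto simp: eigenbasis_def pairwise_def orthogonal_def norm_eq_1)
    also have "\<dots> = sqrt (l b) *\<^sub>R b" using B that by (simp add: eigenbasis_def)
    finally show ?thesis .
  qed
  have "Q ** Q = P"
  proof (subst matrix_eq, intro allI)
    fix x
    have "(Q ** Q) *v x = f (f x)" by (simp add: Qf matrix_vector_mul_assoc[symmetric])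
    also have "\<dots> = (\<Sum>b\<in>B. (sqrt (l b) * (x \<bullet> b)) *\<^sub>R f b)"
      unfolding f_def[of x] using B \<open>linear f\<close>
      by (simp add: linear_sum linear_scale)
    also have "\<dots> = (\<Sum>b\<in>B. (l b * (x \<bullet> b)) *\<^sub>R b)"
      by (intro sum.cong refl) (simp add: fb eigenbasis_nonneg[OF B P] mult.commute mult.left_commute)
    finally show "(Q ** Q) *v x = P *v x" by (simp add: eigenbasis_mult_expand[OF B])
  qed
  moreover have "transpose Q = Q"
    by (simp add: vec_eq_iff transpose_def matrix_nth_eq_dot Qf fdot mult.commute mult.left_commute)
  moreover have "0 \<le> x \<bullet> (Q *v x)" for x
    unfolding Qf fdot using eigenbasis_nonneg[OF B P] by (intro sum_nonneg) (simp add: mult.assoc)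
  ultimately show ?thesis unfolding pos_semidef_def by blast
qed

text \<open>For an eigenvector \<open>b\<close> of \<open>Q'\<close> the defect
  \<open>u = Q b - l b\<close> satisfies \<open>Q u = - l u\<close>. If \<open>l > 0\<close>,
  positivity of \<open>Q\<close> forces \<open>u = 0\<close>; if \<open>l = 0\<close>, then
  \<open>|Q b|^2 = b \<bullet> Q (Q b) = 0\<close>. So \<open>Q\<close> and \<open>Q'\<close> agree
  on a basis.\<close>

lemma pos_semidef_sqrt_unique:
  assumes "pos_semidef (Q :: real^'n^'n)" "pos_semidef Q'" "Q ** Q = Q' ** Q'"
  shows "Q = Q'"
proof -
  obtain B l where B: "eigenbasis Q' B l"
    using pos_semidef_has_eigenbasis[OF assms(2)] .
  have Qb: "Q *v b = l b *\<^sub>R b" if b: "b \<in> B" for b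
  proof -
    have l: "0 \<le> l b" using eigenbasis_nonneg[OF B assms(2) b] .
    have Q'b: "Q' *v b = l b *\<^sub>R b" using B b by (simp add: eigenbasis_def)
    have QQ: "Q *v (Q *v b) = (l b * l b) *\<^sub>R b"
      by (simp add: matrix_vector_mul_assoc assms(3))
         (simp add: matrix_vector_mul_assoc[symmetric] Q'b matrix_vector_mult_scaleR)
    define u where "u = Q *v b - l b *\<^sub>R b"
    have Qu: "Q *v u = - (l b *\<^sub>R u)"
      by (simp add: u_def matrix_vector_mult_diff_distrib matrix_vector_mult_scaleR QQ algebra_simps)
    have "0 \<le> u \<bullet> (Q *v u)" using assms(1) by (simp add: pos_semidef_def)
    then have *: "l b * (u \<bullet> u) \<le> 0" by (simp add: Qu)
    show ?thesis
    proof (cases "l b = 0")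
      case True
      have "(Q *v b) \<bullet> (Q *v b) = b \<bullet> (Q *v (Q *v b))"
        using symmetric_dot_swap[of Q "Q *v b" b] assms(1) by (simp add: pos_semidef_def)
      then show ?thesis by (simp add: QQ True)
    next
      case False
      then have "u \<bullet> u \<le> 0" using * l by (simp add: mult_le_0_iff)
      with inner_ge_zero[of u] have "u \<bullet> u = 0" by linarith
      then show ?thesis by (simp add: u_def)
    qed
  qed
  have "eigenbasis Q B l" using B Qb by (auto simp: eigenbasis_def)
  then show ?thesis using B by (subst matrix_eq) (simp add: eigenbasis_mult_expand)
qed

lemma mat_sqrt_props:
  assumes "pos_semidef (P :: real^'n^'n)"
  shows pos_semidef_mat_sqrt: "pos_semidef (mat_sqrt P)"
    and mat_sqrt_mult_self: "mat_sqrt P ** mat_sqrt P = P"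
proof -
  have "\<exists>!Q. pos_semidef Q \<and> Q ** Q = P"
    using pos_semidef_sqrt_exists[OF assms] pos_semidef_sqrt_unique by metis
  from theI'[OF this] show "pos_semidef (mat_sqrt P)" "mat_sqrt P ** mat_sqrt P = P"
    by (simp_all add: mat_sqrt_def)
qed

text \<open>Cyclicity of the trace removes the square root of the weight from both
  \<open>wnorm_sq\<close> and \<open>exp_trace\<close>.\<close>

lemma trace_mat_sqrt_conj:
  assumes "pos_semidef (P :: real^'n^'n)"
  shows "trace (mat_sqrt P ** C ** mat_sqrt P) = trace (P ** C)"
  by (metis assms mat_sqrt_mult_self matrix_mul_assoc trace_mul_sym)

section \<open>Analysis of matrix-valued functions\<close>

lemma bounded_bilinear_matrix_mult: "bounded_bilinear ((**) :: real^'n^'n \<Rightarrow> real^'n^'n \<Rightarrow> real^'n^'n)"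
  unfolding bilinear_conv_bounded_bilinear[symmetric] bilinear_def
  by (auto intro!: linearI simp: matrix_add_ldistrib matrix_scalar_ac scalar_matrix_assoc
      matrix_matrix_mult_def vec_eq_iff distrib_left distrib_right sum.distrib sum_distrib_left mult_ac)

interpretation matrix_mult: bounded_bilinear "(**) :: real^'n^'n \<Rightarrow> real^'n^'n \<Rightarrow> real^'n^'n"
  by (rule bounded_bilinear_matrix_mult)

lemma trace_scaleR: "trace (c *\<^sub>R A) = c * trace (A :: real^'n^'n)"
  by (simp add: trace_def sum_distrib_left)

lemma transpose_diff: "transpose (A - B) = transpose A - transpose (B :: real^'n^'m)"
  by (simp add: transpose_def vec_eq_iff)

lemma bounded_linear_trace: "bounded_linear (trace :: real^'n^'n \<Rightarrow> real)"
  unfolding linear_conv_bounded_linear[symmetric]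
  by (rule linearI) (simp_all add: trace_add trace_scaleR)

lemma continuous_on_det [continuous_intros]:
  fixes f :: "'a::topological_space \<Rightarrow> real^'n^'n"
  assumes "continuous_on S f"
  shows "continuous_on S (\<lambda>x. det (f x))"
  unfolding det_def
  by (intro continuous_intros continuous_on_component assms)

lemma continuous_on_mat_power [continuous_intros]:
  fixes f :: "'a::topological_space \<Rightarrow> real^'n^'n"
  assumes "continuous_on S f"
  shows "continuous_on S (\<lambda>x. mat_power (f x) k)"
  by (induction k) (auto intro!: matrix_mult.continuous_on assms)

text \<open>The columns of the inverse solve \<open>A y = axis j 1\<close>. Cramer's rule turns
  their entries into quotients of determinants, which shows continuity wherever \<open>det A\<close>
  does not vanish.\<close>

lemma matrix_inv_cramer:
  fixes A :: "real^'n^'n"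
  assumes "det A \<noteq> 0"
  shows "matrix_inv A = (\<chi> i j. det (\<chi> k l. if l = i then axis j 1 $ k else A $ k $ l) / det A)"
proof -
  have "invertible A" using assms by (simp add: invertible_det_nz)
  then have "A *v (matrix_inv A *v axis j 1) = axis j 1" for j
    by (simp add: matrix_vector_mul_assoc matrix_inv_right)
  then have *: "matrix_inv A *v axis j 1 = (\<chi> i. det (\<chi> k l. if l = i then axis j 1 $ k else A $ k $ l) / det A)" for j
    using cramer[OF assms] by blast
  have "matrix_inv A $ i $ j = (matrix_inv A *v axis j 1) $ i" for i j
    by (simp add: matrix_vector_mult_basis column_def)
  then show ?thesis unfolding * by (simp add: vec_eq_iff)
qed

text \<open>On singular matrices \<open>matrix_inv\<close> is \<open>SOME\<close> of an empty predicate, hence constant there.\<close>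

lemma borel_measurable_matrix_inv:
  "(matrix_inv :: real^'n^'n \<Rightarrow> real^'n^'n) \<in> borel_measurable borel"
proof -
  let ?U = "{A :: real^'n^'n. det A \<noteq> 0}"
  let ?f = "\<lambda>A :: real^'n^'n. \<chi> i j. det (\<chi> k l. if l = i then axis j 1 $ k else A $ k $ l) / det A"
  have U: "?U \<in> sets borel"
    by (intro borel_open open_Collect_neq continuous_intros)
  have "continuous_on ?U (\<lambda>A. if l = i then axis j 1 $ k else A $ k $ l)" for i j k l :: 'n
    by (cases "l = i") (auto intro!: continuous_intros)
  then have f: "continuous_on ?U ?f"
    by (intro continuous_on_vec_lambda continuous_on_divide continuous_on_det continuous_on_id) auto
  have eq: "matrix_inv = (\<lambda>A :: real^'n^'n. if A \<in> ?U then ?f A else (SOME A'. False))"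
  proof
    fix A :: "real^'n^'n"
    have "matrix_inv A = (SOME A'. False)" if "det A = 0"
    proof -
      have "\<not> (A ** A' = mat 1 \<and> A' ** A = mat 1)" for A'
        using that unfolding invertible_det_nz[symmetric] invertible_def
        by (metis invertible_def invertible_det_nz)
      then have "(\<lambda>A'. A ** A' = mat 1 \<and> A' ** A = mat 1) = (\<lambda>_. False)" by blast
      then show ?thesis by (simp only: matrix_inv_def)
    qed
    then show "matrix_inv A = (if A \<in> ?U then ?f A else (SOME A'. False))"
      by (auto simp: matrix_inv_cramer)
  qed
  show ?thesis
    unfolding eq by (rule borel_measurable_continuous_on_if[OF U f]) simp
qed

section \<open>Inverse square roots and the relative deviation\<close>

lemma inv_sqrt_props:
  fixes A :: "real^'n^'n"
  assumes A: "pos_def A"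
  shows mat_sqrt_inv_sqrt: "mat_sqrt A ** inv_sqrt A = mat 1"
    and inv_sqrt_mat_sqrt: "inv_sqrt A ** mat_sqrt A = mat 1"
    and transpose_inv_sqrt: "transpose (inv_sqrt A) = inv_sqrt A"
    and inv_sqrt_mult_self: "inv_sqrt A ** inv_sqrt A = matrix_inv A"
proof -
  let ?Q = "mat_sqrt A"
  have sq: "?Q ** ?Q = A" and Q: "pos_semidef ?Q"
    using mat_sqrt_props[OF pos_def_imp_semidef[OF A]] by auto
  have "matrix_inv A ** A = mat 1" by (rule matrix_inv_left[OF pos_def_invertible[OF A]])
  then have "(matrix_inv A ** ?Q) ** ?Q = mat 1" by (simp add: sq matrix_mul_assoc[symmetric])
  then have inv: "invertible ?Q" using invertible_left_inverse by blast
  show 1: "?Q ** inv_sqrt A = mat 1" and 2: "inv_sqrt A ** ?Q = mat 1"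
    by (simp_all add: inv_sqrt_def matrix_inv_right matrix_inv_left inv)
  show "transpose (inv_sqrt A) = inv_sqrt A"
    using Q by (simp add: inv_sqrt_def transpose_matrix_inv[OF inv] pos_semidef_def)
  have "inv_sqrt A ** (inv_sqrt A ** A) = inv_sqrt A ** ((inv_sqrt A ** ?Q) ** ?Q)"
    by (metis sq matrix_mul_assoc)
  also have "\<dots> = mat 1" by (simp add: 2)
  finally have "(inv_sqrt A ** inv_sqrt A) ** A = mat 1" by (simp add: matrix_mul_assoc)
  from matrix_inv_eqI[OF this] show "inv_sqrt A ** inv_sqrt A = matrix_inv A" by simp
qed

lemma inv_sqrt_mult_matrix: "pos_def A \<Longrightarrow> inv_sqrt A ** A ** inv_sqrt A = mat 1"
  by (metis inv_sqrt_props(1,2) mat_sqrt_mult_self matrix_mul_assoc matrix_mul_rid pos_def_imp_semidef)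

text \<open>In this form \<open>mat 1 - rel_dev A Y\<close> is a conjugate of \<open>Y\<close>, so
  traces with the inverse of \<open>Y\<close> become spectral sums of
  \<open>1 / (1 - x)\<close>.\<close>

lemma rel_dev_eq:
  assumes "pos_def A"
  shows "rel_dev A Y = mat 1 - inv_sqrt A ** Y ** inv_sqrt A"
  by (simp add: rel_dev_def matrix_mult.diff_left matrix_mult.diff_right inv_sqrt_mult_matrix[OF assms])

lemma pos_semidef_conj:
  assumes "pos_semidef P" "transpose C = C"
  shows "pos_semidef (C ** P ** C)"
  unfolding pos_semidef_def
proof (intro conjI allI)
  show "transpose (C ** P ** C) = C ** P ** C"
    using assms by (simp add: pos_semidef_def matrix_transpose_mul matrix_mul_assoc)
  fix x
  have "x \<bullet> ((C ** P ** C) *v x) = (C *v x) \<bullet> (P *v (C *v x))"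
    using symmetric_dot_swap[OF assms(2), of x "P *v (C *v x)"]
    by (simp add: matrix_vector_mul_assoc[symmetric] inner_commute)
  then show "0 \<le> x \<bullet> ((C ** P ** C) *v x)" using assms(1) by (simp add: pos_semidef_def)
qed

lemma pos_semidef_conj_weight: "pos_def A \<Longrightarrow> pos_semidef R \<Longrightarrow> pos_semidef (conj_weight A R)"
  unfolding conj_weight_def by (intro pos_semidef_conj transpose_inv_sqrt)

lemma trace_conj_weight_mult:
  "trace (conj_weight A R ** C) = trace (R ** (inv_sqrt A ** C ** inv_sqrt A))"
  unfolding conj_weight_def by (metis matrix_mul_assoc trace_mul_sym)

text \<open>In an eigenbasis of \<open>A^(-1/2) Y A^(-1/2)\<close>, every trace occurring below becomes a moment of one
  and the same discrete measure, with nonnegative weights \<open>w\<close> and atoms \<open>x\<close>.\<close>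

lemma rel_dev_moments:
  fixes A R Y :: "real^'n^'n"
  assumes A: "pos_def A" and R: "pos_semidef R" and Y: "pos_def Y"
    and less: "Y \<prec> (2 - \<epsilon>) *\<^sub>R A" and \<epsilon>: "0 < \<epsilon>"
  obtains B :: "(real^'n) set" and w x where "finite B"
    "\<And>b. b \<in> B \<Longrightarrow> 0 \<le> w b" "\<And>b. b \<in> B \<Longrightarrow> \<epsilon> - 1 < x b" "\<And>b. b \<in> B \<Longrightarrow> x b < 1"
    "sum w B = trace (R ** matrix_inv A)"
    "\<And>k. trace (conj_weight A R ** mat_power (rel_dev A Y) k) = (\<Sum>b\<in>B. w b * x b ^ k)"
    "\<And>k i j. \<bar>mat_power (rel_dev A Y) k $ i $ j\<bar> \<le> CARD('n)"
    "trace (R ** matrix_inv Y) = (\<Sum>b\<in>B. w b / (1 - x b))"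
    "trace (R ** matrix_inv Y ** A ** matrix_inv Y) = (\<Sum>b\<in>B. w b / (1 - x b)^2)"
proof -
  define H where "H = inv_sqrt A"
  define Q where "Q = mat_sqrt A"
  define S where "S = conj_weight A R"
  define X where "X = rel_dev A Y"
  \<comment> \<open>\<open>T\<close> is the inverse of \<open>H ** Y ** H = mat 1 - X\<close>, hence
    it shares the eigenvectors of \<open>X\<close>.\<close>
  define T where "T = Q ** matrix_inv Y ** Q"
  note inv = inv_sqrt_props[OF A, folded H_def Q_def]
  have QQ: "Q ** Q = A" by (simp add: Q_def mat_sqrt_mult_self pos_def_imp_semidef A)
  have QH': "Q ** (H ** C) = C" and HQ': "H ** (Q ** C) = C" for C
    by (simp_all add: matrix_mul_assoc inv)
  have Hsym: "transpose H = H" by (rule inv(3))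
  have Ysym: "transpose Y = Y" using Y by (simp add: pos_def_def)
  have TW: "T ** (H ** Y ** H) = mat 1"
  proof -
    have "T ** (H ** Y ** H) = Q ** (matrix_inv Y ** Y) ** H"
      by (simp add: T_def matrix_mul_assoc[symmetric] QH')
    then show ?thesis by (simp add: matrix_inv_left pos_def_invertible Y inv)
  qed
  have Xeq: "X = mat 1 - H ** Y ** H" unfolding X_def H_def by (rule rel_dev_eq[OF A])
  have Xsym: "transpose X = X"
    by (simp add: Xeq transpose_diff matrix_transpose_mul Hsym Ysym matrix_mul_assoc)
  obtain B x where B: "eigenbasis X B x" using symmetric_has_eigenbasis[OF Xsym] by blast
  define w where "w b = b \<bullet> (S *v b)" for b
  have S: "pos_semidef S" unfolding S_def by (rule pos_semidef_conj_weight[OF A R])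
  have Wb: "(H ** Y ** H) *v b = (1 - x b) *\<^sub>R b" if "b \<in> B" for b
  proof -
    have "X *v b = x b *\<^sub>R b" using B that by (simp add: eigenbasis_def)
    then show ?thesis unfolding Xeq by (simp add: matrix_vector_mult_diff_rdistrib algebra_simps)
  qed
  have form: "b \<bullet> ((H ** C ** H) *v b) = (H *v b) \<bullet> (C *v (H *v b))" for b C
    using symmetric_dot_swap[OF Hsym, of b "C *v (H *v b)"]
    by (simp add: matrix_vector_mul_assoc[symmetric] inner_commute)
  have bb: "b \<bullet> b = 1" if "b \<in> B" for b using B that by (simp add: eigenbasis_def norm_eq_1)
  have Hb: "H *v b \<noteq> 0" if "b \<in> B" for b
  proof
    assume "H *v b = 0"
    then have "Q *v (H *v b) = 0" by simp
    then show False using bb[OF that] by (simp add: matrix_vector_mul_assoc inv)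
  qed
  \<comment> \<open>Testing positivity of \<open>Y\<close> at \<open>H *v b\<close> bounds the
    eigenvalue by 1 from above; testing \<open>(2 - \<epsilon>) A - Y\<close> at the same vector
    gives the lower bound \<open>\<epsilon> - 1\<close>.\<close>
  have x1: "x b < 1" if "b \<in> B" for b
  proof -
    have "0 < (H *v b) \<bullet> (Y *v (H *v b))" using Y Hb[OF that] by (simp add: pos_def_def)
    then show ?thesis by (simp add: form[symmetric] Wb[OF that] bb[OF that])
  qed
  have x2: "\<epsilon> - 1 < x b" if "b \<in> B" for b
  proof -
    have "0 < (H *v b) \<bullet> (((2 - \<epsilon>) *\<^sub>R A - Y) *v (H *v b))"
      using less Hb[OF that] by (simp add: loewner_less_def pos_def_def)
    also have "\<dots> = (2 - \<epsilon>) * (b \<bullet> ((H ** A ** H) *v b)) - b \<bullet> ((H ** Y ** H) *v b)"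
      unfolding form by (simp add: matrix_vector_mult_diff_rdistrib scaleR_matrix_vector_assoc[symmetric] inner_diff_right)
    also have "\<dots> = (2 - \<epsilon>) - (1 - x b)"
      using inv_sqrt_mult_matrix[OF A] by (simp add: H_def[symmetric] Wb[OF that] bb[OF that])
    finally show ?thesis by simp
  qed
  have Tb: "T *v b = (1 / (1 - x b)) *\<^sub>R b" if "b \<in> B" for b
  proof -
    have "b = T *v ((H ** Y ** H) *v b)" by (simp add: matrix_vector_mul_assoc TW)
    also have "\<dots> = (1 - x b) *\<^sub>R (T *v b)" by (simp add: Wb[OF that] matrix_vector_mult_scaleR)
    finally have "(1 / (1 - x b)) *\<^sub>R b = (1 / (1 - x b)) *\<^sub>R ((1 - x b) *\<^sub>R (T *v b))" by simp
    then show ?thesis using x1[OF that] by simp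
  qed
  have trS: "trace (S ** C) = (\<Sum>b\<in>B. w b * c b)" if "\<And>b. b \<in> B \<Longrightarrow> C *v b = c b *\<^sub>R b" for C c
    unfolding trace_eigenbasis[OF B]
    by (intro sum.cong refl) (simp add: matrix_vector_mul_assoc[symmetric] that matrix_vector_mult_scaleR w_def)
  have tr: "trace (S ** C) = trace (R ** (H ** C ** H))" for C
    unfolding S_def H_def by (rule trace_conj_weight_mult)
  have pw: "trace (S ** mat_power X k) = (\<Sum>b\<in>B. w b * x b ^ k)" for k
    using B by (intro trS mat_power_eigenvector) (simp add: eigenbasis_def)
  show thesis
  proof (rule that)
    show "finite B" using B by (simp add: eigenbasis_def)
    show "0 \<le> w b" for b using S by (simp add: w_def pos_semidef_def)
    show "\<epsilon> - 1 < x b" if "b \<in> B" for b by (rule x2[OF that])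
    show "x b < 1" if "b \<in> B" for b by (rule x1[OF that])
    show "sum w B = trace (R ** matrix_inv A)"
      using pw[of 0] tr[of "mat 1"] by (simp add: inv(4))
    show "trace (conj_weight A R ** mat_power (rel_dev A Y) k) = (\<Sum>b\<in>B. w b * x b ^ k)" for k
      using pw by (simp add: S_def X_def)
    have "\<bar>x b ^ k\<bar> \<le> 1" if "b \<in> B" for b k
      using x1[OF that] x2[OF that] \<epsilon> by (auto simp: power_abs intro!: power_le_one)
    then show "\<bar>mat_power (rel_dev A Y) k $ i $ j\<bar> \<le> CARD('n)" for k i j
      using eigenbasis_nth_bound[OF eigenbasis_mat_power[OF B]] by (simp add: X_def)
    have "trace (R ** matrix_inv Y) = trace (S ** T)"
      by (simp add: tr T_def matrix_mul_assoc[symmetric] HQ' inv)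
    also have "\<dots> = (\<Sum>b\<in>B. w b * (1 / (1 - x b)))" by (rule trS[OF Tb])
    finally show "trace (R ** matrix_inv Y) = (\<Sum>b\<in>B. w b / (1 - x b))" by simp
    \<comment> \<open>The adjacent factors \<open>Q ** Q\<close> inside \<open>T ** T\<close>
      recombine to \<open>A\<close>.\<close>
    have "trace (R ** matrix_inv Y ** A ** matrix_inv Y) = trace (S ** (T ** T))"
      by (simp add: tr T_def matrix_mul_assoc[symmetric] HQ' inv QQ[symmetric])
    also have "\<dots> = (\<Sum>b\<in>B. w b * (1 / (1 - x b))^2)"
      by (rule trS) (simp add: matrix_vector_mul_assoc[symmetric] Tb matrix_vector_mult_scaleR power2_eq_square)
    finally show "trace (R ** matrix_inv Y ** A ** matrix_inv Y) = (\<Sum>b\<in>B. w b / (1 - x b)^2)"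
      by (simp add: power_divide)
  qed
qed

text \<open>With the weight \<open>A\<close>, both cross terms of the square contain
  \<open>A\<close> next to its inverse and collapse to \<open>Y\<close>.\<close>

lemma wnorm_sq_scaled_inv:
  fixes A R Y :: "real^'n^'n"
  assumes A: "pos_def A" and R: "pos_semidef R" and Y: "transpose Y = Y"
  shows "wnorm_sq A R (c *\<^sub>R Y - matrix_inv A) =
    c^2 * trace (R ** Y ** A ** Y) - 2 * c * trace (R ** Y) + trace (R ** matrix_inv A)"
proof -
  let ?I = "matrix_inv A" and ?D = "c *\<^sub>R Y - matrix_inv A"
  note inv = pos_def_invertible[OF A]
  have I: "?I ** A = mat 1" "A ** ?I = mat 1"
    by (simp_all add: matrix_inv_left matrix_inv_right inv)
  have "transpose ?D = ?D"
    using Y pos_def_matrix_inv[OF A] by (simp add: pos_def_def transpose_diff transpose_scalar)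
  then have "wnorm_sq A R ?D = trace (R ** (?D ** A ** ?D))"
    by (simp add: wnorm_sq_def matrix_mul_assoc[symmetric]
        trace_mat_sqrt_conj[OF R, of "?D ** (A ** ?D)", simplified matrix_mul_assoc[symmetric]])
  also have "?D ** A ** ?D = c^2 *\<^sub>R (Y ** A ** Y) - (2 * c) *\<^sub>R Y + ?I"
  proof -
    have "?D ** A ** ?D = (c *\<^sub>R (Y ** A) - mat 1) ** ?D"
      by (simp add: matrix_mult.diff_left matrix_mult.scaleR_left I)
    also have "\<dots> = c *\<^sub>R c *\<^sub>R (Y ** A ** Y) - c *\<^sub>R (Y ** (A ** ?I)) - c *\<^sub>R Y + ?I"
      by (simp add: matrix_mult.diff_left matrix_mult.diff_right matrix_mult.scaleR_left
          matrix_mult.scaleR_right matrix_mul_assoc algebra_simps)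
    finally show ?thesis by (simp add: I power2_eq_square algebra_simps scaleR_add_left[symmetric])
  qed
  finally show ?thesis
    by (simp add: matrix_mult.add_right matrix_mult.diff_right matrix_mult.scaleR_right
        trace_add trace_sub trace_scaleR matrix_mul_assoc)
qed

section \<open>The weighted sums\<close>

text \<open>The sequence is a parameter because it will be the expected moments, the moments at one
  outcome, or the powers of a single eigenvalue.\<close>

definition weighted_num :: "(nat \<Rightarrow> real) \<Rightarrow> nat \<Rightarrow> real" where
  "weighted_num m N = (\<Sum>k\<le>2*N. weight_num N k * m k)"

definition weighted_den :: "(nat \<Rightarrow> real) \<Rightarrow> nat \<Rightarrow> real" where
  "weighted_den m N = (\<Sum>k\<le>2*N. weight_den N k * m k)"

lemma weighted_num_eq:
  "weighted_num m N = (\<Sum>k<2*N. real k * m k) + (2 * real N - 1) / 2 * m (2 * N)"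
proof -
  have "{..2*N} = insert (2*N) {..<2*N}" by auto
  then show ?thesis by (simp add: weighted_num_def weight_num_def)
qed

lemma weighted_den_eq:
  "weighted_den m N = (\<Sum>k<2*N. (real k + 1) * m k) + real N * m (2 * N)"
proof -
  have "{..2*N} = insert (2*N) {..<2*N}" by auto
  then show ?thesis by (simp add: weighted_den_def weight_den_def)
qed

text \<open>The weight at \<open>2N\<close> rises from \<open>(2N-1)/2\<close> to \<open>2N\<close>,
  and the new weights at \<open>2N+1\<close> and \<open>2N+2\<close> are \<open>2N+1\<close> and
  \<open>(2N+1)/2\<close>: the increments have the pattern 1, 2, 1 of
  \<open>(1+x)^2\<close>.\<close>

lemma weighted_num_Suc:
  "weighted_num m (Suc N) =
    weighted_num m N + (2 * real N + 1) / 2 * (m (2*N) + 2 * m (2*N+1) + m (2*N+2))"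
  by (simp add: weighted_num_eq field_simps)

lemma weighted_den_Suc:
  "weighted_den m (Suc N) =
    weighted_den m N + (real N + 1) * (m (2*N) + 2 * m (2*N+1) + m (2*N+2))"
  by (simp add: weighted_den_eq field_simps)

text \<open>The difference is a plain partial sum with halved last term, so the limit of the
  numerators follows from that of the denominators.\<close>

lemma weighted_den_minus_num:
  "weighted_den m N - weighted_num m N = (\<Sum>k<2*N. m k) + m (2*N) / 2"
  by (simp add: weighted_num_eq weighted_den_eq sum.distrib field_simps)

text \<open>The index 0 is only the base of the inductions; there the last weight of the numerator
  is \<open>- 1 / 2\<close> and the denominator vanishes.\<close>

lemma weighted_0: "weighted_num m 0 = - m 0 / 2" "weighted_den m 0 = 0"
  by (simp_all add: weighted_num_eq weighted_den_eq)

lemma weighted_sum: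
  "weighted_num (\<lambda>k. \<Sum>b\<in>B. w b * g b k) N = (\<Sum>b\<in>B. w b * weighted_num (g b) N)"
  "weighted_den (\<lambda>k. \<Sum>b\<in>B. w b * g b k) N = (\<Sum>b\<in>B. w b * weighted_den (g b) N)"
  unfolding weighted_num_def weighted_den_def sum_distrib_left
  by (subst sum.swap, simp add: mult_ac)+

section \<open>Monotonicity of the ratios when the increments are nonnegative\<close>

context
  fixes m :: "nat \<Rightarrow> real"
  assumes m0: "0 \<le> m 0"
    and d: "\<And>j. 0 \<le> m (2*j) + 2 * m (2*j+1) + m (2*j+2)"
begin

lemma weighted_den_mono: "weighted_den m N \<le> weighted_den m (Suc N)"
  unfolding weighted_den_Suc using d[of N] by simp

lemma weighted_den_nonneg: "0 \<le> weighted_den m N"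
  by (induction N) (auto simp: weighted_0 intro: order_trans[OF _ weighted_den_mono])

lemma weighted_num_le_den: "weighted_num m N \<le> weighted_den m N"
proof (induction N)
  case (Suc N)
  have "(2 * real N + 1) / 2 * (m (2*N) + 2 * m (2*N+1) + m (2*N+2))
     \<le> (real N + 1) * (m (2*N) + 2 * m (2*N+1) + m (2*N+2))"
    using d[of N] by (intro mult_right_mono) auto
  with Suc show ?case unfolding weighted_num_Suc weighted_den_Suc by linarith
qed (simp add: weighted_0 m0)

text \<open>The numerator starts at this value for \<open>N = 0\<close> and only grows; with
  \<open>weighted_num_le_den\<close> this bounds its modulus.\<close>

lemma weighted_num_ge: "- m 0 / 2 \<le> weighted_num m N"
proof (induction N)
  case (Suc N)
  have "0 \<le> (2 * real N + 1) / 2 * (m (2*N) + 2 * m (2*N+1) + m (2*N+2))"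
    using d[of N] by (intro mult_nonneg_nonneg) auto
  with Suc show ?case unfolding weighted_num_Suc by linarith
qed (simp add: weighted_0)

text \<open>The ratio of the increments of numerator and denominator is \<open>(2N+1)/(2N+2)\<close>, which
  increases with \<open>N\<close>; hence it bounds the ratio of the sums accumulated so far.\<close>

lemma weighted_num_ratio: "(2 * real N + 2) * weighted_num m N \<le> (2 * real N + 1) * weighted_den m N"
proof (induction N)
  case (Suc N)
  let ?a = "weighted_num m N" and ?c = "weighted_den m N"
    and ?d = "m (2*N) + 2 * m (2*N+1) + m (2*N+2)"
  have "(2 * real N + 2) * ((2 * real N + 4) * ?a) = (2 * real N + 4) * ((2 * real N + 2) * ?a)"
    by simp
  also have "\<dots> \<le> (2 * real N + 4) * ((2 * real N + 1) * ?c)"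
    using Suc by (intro mult_left_mono) auto
  also have "\<dots> \<le> (2 * real N + 2) * ((2 * real N + 3) * ?c)"
  proof -
    have "(2 * real N + 4) * (2 * real N + 1) * ?c \<le> (2 * real N + 2) * (2 * real N + 3) * ?c"
      by (intro mult_right_mono weighted_den_nonneg) (simp add: algebra_simps)
    then show ?thesis by (simp only: mult.assoc)
  qed
  finally have 1: "(2 * real N + 4) * ?a \<le> (2 * real N + 3) * ?c"
    by (rule mult_left_le_imp_le) simp
  have 2: "(2 * real N + 4) * ((2 * real N + 1) / 2) * ?d \<le> (2 * real N + 3) * (real N + 1) * ?d"
    using d[of N] by (intro mult_right_mono) (auto simp: field_simps)
  have "2 * real (Suc N) + 2 = 2 * real N + 4" "2 * real (Suc N) + 1 = 2 * real N + 3" by simp_all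
  then show ?case unfolding weighted_num_Suc weighted_den_Suc
    using 1 2 by (simp only: distrib_left mult.assoc[symmetric])
qed (simp add: weighted_0 m0)

lemma weighted_ratio_mono:
  assumes "0 < weighted_den m N"
  shows "weighted_num m N / weighted_den m N \<le> weighted_num m (Suc N) / weighted_den m (Suc N)"
proof -
  let ?a = "weighted_num m N" and ?c = "weighted_den m N"
    and ?d = "m (2*N) + 2 * m (2*N+1) + m (2*N+2)"
  \<comment> \<open>After cross-multiplication of the claim the common term \<open>?a * ?c\<close>
    cancels, and this inequality is what remains.\<close>
  have "((2 * real N + 2) * ?a) * (?d / 2) \<le> ((2 * real N + 1) * ?c) * (?d / 2)"
    using d[of N] by (intro mult_right_mono weighted_num_ratio) auto
  then have "?a * weighted_den m (Suc N) \<le> weighted_num m (Suc N) * ?c"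
    unfolding weighted_num_Suc weighted_den_Suc by (simp add: field_simps)
  then show ?thesis
    using assms weighted_den_mono[of N] by (simp add: divide_simps)
qed

end

section \<open>Limits for the powers of one number\<close>

lemma power_increment_nonneg: "0 \<le> x ^ (2*j) + 2 * x ^ (2*j+1) + (x::real) ^ (2*j+2)"
proof -
  have "x ^ (2*j) + 2 * x ^ (2*j+1) + x ^ (2*j+2) = (x ^ j * (1 + x))^2"
    by (simp add: power_mult power2_eq_square power_mult_distrib algebra_simps power_even_eq)
  then show ?thesis by simp
qed

text \<open>Each increment is \<open>(1 + x)^2 * (x^2)^N\<close> up to its factor
  \<open>N + 1\<close>, so the sum telescopes into a partial sum of the differentiated geometric
  series in \<open>x^2\<close>.\<close>

lemma weighted_den_power:
  "weighted_den (\<lambda>k. x ^ k) N = (1 + x)^2 * (\<Sum>j<N. real (Suc j) * (x^2) ^ j)"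
proof (induction N)
  case (Suc N)
  have "x ^ (2*N) + 2 * x ^ (2*N+1) + x ^ (2*N+2) = (1 + x)^2 * (x^2) ^ N"
    by (simp add: power_mult power2_eq_square algebra_simps)
  then show ?case unfolding weighted_den_Suc Suc by (simp add: algebra_simps)
qed (simp add: weighted_0)

text \<open>The denominators increase with \<open>N\<close> even for negative \<open>x\<close>, so
  their limit is also an upper bound, as needed for dominated convergence.\<close>

lemma weighted_den_power_sums:
  assumes "\<bar>x\<bar> < 1"
  shows "(\<lambda>N. weighted_den (\<lambda>k. x ^ k) N) \<longlonglongrightarrow> 1 / (1 - x)^2"
    and "weighted_den (\<lambda>k. x ^ k) N \<le> 1 / (1 - x)^2"
proof -
  have "norm (x^2) < 1" using assms by (simp add: abs_square_less_1)
  from geometric_deriv_sums[OF this]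
  have s: "(\<lambda>j. real (Suc j) * (x^2) ^ j) sums (1 / (1 - x^2)^2)" by simp
  have eq: "(1 + x)^2 * (1 / (1 - x^2)^2) = 1 / (1 - x)^2"
  proof -
    have "(1 - x^2)^2 = (1 + x)^2 * (1 - x)^2"
      by (simp add: power2_eq_square algebra_simps)
    moreover have "(1 + x)^2 \<noteq> 0" using assms by auto
    ultimately show ?thesis by simp
  qed
  show lim: "(\<lambda>N. weighted_den (\<lambda>k. x ^ k) N) \<longlonglongrightarrow> 1 / (1 - x)^2"
    unfolding weighted_den_power eq[symmetric]
    by (intro tendsto_mult tendsto_const s[unfolded sums_def])
  have "incseq (weighted_den (\<lambda>k. x ^ k))"
    by (rule incseq_SucI, rule weighted_den_mono) (simp_all add: power_increment_nonneg[simplified])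
  from incseq_le[OF this lim] show "weighted_den (\<lambda>k. x ^ k) N \<le> 1 / (1 - x)^2" .
qed

lemma weighted_num_power_lim:
  assumes "\<bar>x\<bar> < 1"
  shows "(\<lambda>N. weighted_num (\<lambda>k. x ^ k) N) \<longlonglongrightarrow> 1 / (1 - x)^2 - 1 / (1 - x)"
proof -
  have dbl: "filterlim (\<lambda>N::nat. 2 * N) sequentially sequentially"
    by (rule mult_nat_left_at_top) simp
  have "(\<lambda>n. x ^ n) sums (1 / (1 - x))" using assms by (intro geometric_sums) simp
  then have 1: "(\<lambda>N. \<Sum>k<2*N. x ^ k) \<longlonglongrightarrow> 1 / (1 - x)"
    unfolding sums_def by (rule filterlim_compose[OF _ dbl])
  have "(\<lambda>n. x ^ n) \<longlonglongrightarrow> 0" using assms by (intro LIMSEQ_power_zero) simp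
  then have 2: "(\<lambda>N. x ^ (2*N)) \<longlonglongrightarrow> 0" by (rule filterlim_compose[OF _ dbl])
  have "(\<lambda>N. weighted_den (\<lambda>k. x ^ k) N - ((\<Sum>k<2*N. x ^ k) + x ^ (2*N) / 2))
      \<longlonglongrightarrow> 1 / (1 - x)^2 - (1 / (1 - x) + 0 / 2)"
    by (intro tendsto_diff tendsto_add tendsto_divide weighted_den_power_sums 1 2 tendsto_const assms) simp
  then show ?thesis by (simp add: weighted_den_minus_num[symmetric])
qed

text \<open>The scalar facts are summed against the spectral weights at a fixed value
  \<open>Y\<close> of the random matrix; everything here is later integrated. The bounds
  \<open>v\<close> and \<open>v + s\<close> do not depend on \<open>N\<close>.\<close>

lemma rel_dev_trace_facts:
  fixes A R Y :: "real^'n^'n"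
  assumes A: "pos_def A" and R: "pos_semidef R" and Y: "pos_def Y"
    and less: "Y \<prec> (2 - \<epsilon>) *\<^sub>R A" and \<epsilon>: "0 < \<epsilon>"
  defines "p \<equiv> \<lambda>k. trace (conj_weight A R ** mat_power (rel_dev A Y) k)"
    and "s \<equiv> trace (R ** matrix_inv A)"
    and "u \<equiv> trace (R ** matrix_inv Y)"
    and "v \<equiv> trace (R ** matrix_inv Y ** A ** matrix_inv Y)"
  shows "p 0 = s" "0 \<le> p (2 * j)" "0 \<le> p (2*j) + 2 * p (2*j+1) + p (2*j+2)"
    "\<epsilon>^2 * s \<le> p 0 + 2 * p 1 + p 2"
    "weighted_den p \<longlonglongrightarrow> v" "weighted_num p \<longlonglongrightarrow> v - u"
    "\<bar>weighted_den p N\<bar> \<le> v" "\<bar>weighted_num p N\<bar> \<le> v + s" "0 \<le> u" "s \<le> 4 * v"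
    "\<bar>mat_power (rel_dev A Y) k $ i $ l\<bar> \<le> CARD('n)"
proof -
  obtain B :: "(real^'n) set" and w x where B: "finite B"
    and w: "\<And>b. b \<in> B \<Longrightarrow> 0 \<le> w b" and x1: "\<And>b. b \<in> B \<Longrightarrow> \<epsilon> - 1 < x b"
    and x2: "\<And>b. b \<in> B \<Longrightarrow> x b < 1"
    and s: "sum w B = s" and p: "\<And>k. p k = (\<Sum>b\<in>B. w b * x b ^ k)"
    and bnd: "\<And>k i j. \<bar>mat_power (rel_dev A Y) k $ i $ j\<bar> \<le> CARD('n)"
    and u: "u = (\<Sum>b\<in>B. w b / (1 - x b))" and v: "v = (\<Sum>b\<in>B. w b / (1 - x b)^2)"
    unfolding p_def s_def u_def v_def by (rule rel_dev_moments[OF A R Y less \<epsilon>]) blast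
  have x: "\<bar>x b\<bar> < 1" if "b \<in> B" for b using x1[OF that] x2[OF that] \<epsilon> by auto
  have p': "p = (\<lambda>k. \<Sum>b\<in>B. w b * x b ^ k)" by (rule ext) (rule p)
  have num: "weighted_num p = (\<lambda>N. \<Sum>b\<in>B. w b * weighted_num (\<lambda>k. x b ^ k) N)"
    and den: "weighted_den p = (\<lambda>N. \<Sum>b\<in>B. w b * weighted_den (\<lambda>k. x b ^ k) N)"
    unfolding p' weighted_sum by (rule refl)+
  show "p 0 = s" by (simp add: p s)
  show p2: "0 \<le> p (2 * j)" for j unfolding p by (intro sum_nonneg mult_nonneg_nonneg w) auto
  have inc: "p (2*j) + 2 * p (2*j+1) + p (2*j+2)
      = (\<Sum>b\<in>B. w b * (x b ^ (2*j) + 2 * x b ^ (2*j+1) + x b ^ (2*j+2)))" for j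
    unfolding p sum_distrib_left sum.distrib[symmetric] by (intro sum.cong refl) (simp add: algebra_simps)
  show d: "0 \<le> p (2*j) + 2 * p (2*j+1) + p (2*j+2)" for j
    unfolding inc by (intro sum_nonneg mult_nonneg_nonneg w power_increment_nonneg)
  have "\<epsilon>^2 * s = (\<Sum>b\<in>B. w b * \<epsilon>^2)" by (simp add: s[symmetric] sum_distrib_right mult.commute)
  \<comment> \<open>The gap \<open>\<epsilon> < 1 + x b\<close> keeps the first increment away from
    zero, which later makes all denominators from \<open>N = 1\<close> on positive.\<close>
  also have "\<dots> \<le> (\<Sum>b\<in>B. w b * (1 + x b)^2)"
    using x1 \<epsilon> w by (intro sum_mono mult_left_mono power_mono) force+
  also have "\<dots> = (\<Sum>b\<in>B. w b * (x b ^ (2*0) + 2 * x b ^ (2*0+1) + x b ^ (2*0+2)))"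
    by (intro sum.cong refl) (simp add: power2_eq_square algebra_simps)
  finally show "\<epsilon>^2 * s \<le> p 0 + 2 * p 1 + p 2" unfolding inc[symmetric] by (simp add: numeral_2_eq_2)
  have "(\<lambda>N. \<Sum>b\<in>B. w b * weighted_den (\<lambda>k. x b ^ k) N) \<longlonglongrightarrow> (\<Sum>b\<in>B. w b * (1 / (1 - x b)^2))"
    by (intro tendsto_sum tendsto_mult tendsto_const weighted_den_power_sums x)
  then show "weighted_den p \<longlonglongrightarrow> v" by (simp add: den v)
  have "(\<lambda>N. \<Sum>b\<in>B. w b * weighted_num (\<lambda>k. x b ^ k) N)
      \<longlonglongrightarrow> (\<Sum>b\<in>B. w b * (1 / (1 - x b)^2 - 1 / (1 - x b)))"
    by (intro tendsto_sum tendsto_mult tendsto_const weighted_num_power_lim x)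
  then show "weighted_num p \<longlonglongrightarrow> v - u"
    by (simp add: num u v right_diff_distrib sum_subtractf)
  have "weighted_den p N \<le> (\<Sum>b\<in>B. w b * (1 / (1 - x b)^2))"
    unfolding den by (intro sum_mono mult_left_mono weighted_den_power_sums x w)
  then have dv: "weighted_den p N \<le> v" by (simp add: v)
  have p0: "0 \<le> p 0" using p2[of 0] by simp
  note seq = weighted_den_nonneg[of p] weighted_num_le_den[of p] weighted_num_ge[of p]
  show "\<bar>weighted_den p N\<bar> \<le> v" using seq(1)[OF p0 d] dv by simp
  \<comment> \<open>From above the numerator is bounded by the denominator, hence by
    \<open>v\<close>; from below by \<open>- p 0 / 2 = - s / 2\<close>.\<close>
  show "\<bar>weighted_num p N\<bar> \<le> v + s"
    using seq(2)[OF p0 d, of N] seq(3)[OF p0 d, of N] seq(1)[OF p0 d, of N] dv p0 \<open>p 0 = s\<close> by linarith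
  show "0 \<le> u" unfolding u using x2 w by (intro sum_nonneg divide_nonneg_pos) auto
  \<comment> \<open>Since \<open>0 < 1 - x b < 2\<close>, division by the square costs at most a
    factor 4; this comparison will give \<open>a > 0\<close>.\<close>
  have "w b \<le> 4 * (w b / (1 - x b)^2)" if "b \<in> B" for b
  proof -
    have "(1 - x b)^2 \<le> 2^2" using x[OF that] by (intro power_mono) auto
    then have "w b * (1 - x b)^2 \<le> w b * 4" using w[OF that] by (intro mult_left_mono) auto
    then show ?thesis using x[OF that] by (simp add: pos_le_divide_eq mult.commute)
  qed
  then show "s \<le> 4 * v" unfolding s[symmetric] v sum_distrib_left by (intro sum_mono)
  show "\<bar>mat_power (rel_dev A Y) k $ i $ l\<bar> \<le> CARD('n)" by (rule bnd)
qed

section \<open>Integrability and independence\<close>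

lemma borel_measurable_continuous_compose:
  assumes "continuous_on UNIV f" "g \<in> borel_measurable M"
  shows "(\<lambda>\<omega>. f (g \<omega>)) \<in> borel_measurable M"
  using borel_measurable_continuous_onI[OF assms(1)] assms(2) by (rule measurable_compose_rev)

lemma continuous_on_transpose:
  fixes f :: "'a::topological_space \<Rightarrow> real^'n^'m"
  assumes "continuous_on S f"
  shows "continuous_on S (\<lambda>x. transpose (f x))"
  unfolding transpose_def by (intro continuous_on_vec_lambda continuous_intros assms)

lemma norm_matrix_le_sum: "norm (C :: real^'n^'m) \<le> (\<Sum>i\<in>UNIV. \<Sum>j\<in>UNIV. \<bar>C $ i $ j\<bar>)"
proof -
  have "norm C \<le> (\<Sum>i\<in>UNIV. norm (C $ i))" unfolding norm_vec_def by (rule L2_set_le_sum) simp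
  also have "\<dots> \<le> (\<Sum>i\<in>UNIV. \<Sum>j\<in>UNIV. \<bar>C $ i $ j\<bar>)" by (intro sum_mono norm_le_l1_cart)
  finally show ?thesis .
qed

text \<open>The norm of \<open>real^'n^'n\<close> is the Frobenius norm; this links the hypothesis
  on the squared inverse to square integrability of the inverse.\<close>

lemma norm_sq_symmetric:
  assumes "transpose Y = (Y :: real^'n^'n)"
  shows "(norm Y)^2 = trace (mat_power Y 2)"
proof -
  have "trace (mat_power Y 2) = trace (transpose Y ** Y)"
    by (simp add: assms numeral_2_eq_2)
  also have "\<dots> = (\<Sum>i\<in>UNIV. \<Sum>j\<in>UNIV. Y $ j $ i * Y $ j $ i)"
    by (simp add: trace_def matrix_matrix_mult_def transpose_def)
  also have "\<dots> = (\<Sum>j\<in>UNIV. \<Sum>i\<in>UNIV. Y $ j $ i * Y $ j $ i)" by (rule sum.swap)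
  also have "\<dots> = (norm Y)^2" by (simp add: power2_norm_eq_inner inner_vec_def)
  finally show ?thesis by simp
qed

text \<open>Functions of \<open>X\<close> and \<open>Y\<close> generate smaller sigma-algebras.
  Passing to real values leads from \<open>indep_rv\<close> to \<open>indep_var\<close>, where
  product expectations factor.\<close>

lemma (in prob_space) indep_rv_compose:
  fixes f :: "'b::topological_space \<Rightarrow> real" and g :: "'c::topological_space \<Rightarrow> real"
  assumes ind: "indep_rv M X Y" and X: "X \<in> borel_measurable M" and Y: "Y \<in> borel_measurable M"
    and f: "f \<in> borel_measurable borel" and g: "g \<in> borel_measurable borel"
  shows "indep_var borel (\<lambda>\<omega>. f (X \<omega>)) borel (\<lambda>\<omega>. g (Y \<omega>))"
proof -
  have sub: "sigma_sets (space M) {(\<lambda>\<omega>. h (Z \<omega>)) -` A \<inter> space M |A. A \<in> sets borel}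
      \<subseteq> sets (vimage_algebra (space M) Z borel)" if "h \<in> borel_measurable borel"
    for h :: "'d::topological_space \<Rightarrow> real" and Z
  proof -
    have "(\<lambda>\<omega>. h (Z \<omega>)) -` A \<inter> space M \<in> sets (vimage_algebra (space M) Z borel)"
      if A: "A \<in> sets borel" for A
    proof -
      have "h -` A \<in> sets borel" using measurable_sets[OF \<open>h \<in> _\<close> A] by simp
      then have "Z -` (h -` A) \<inter> space M \<in> sets (vimage_algebra (space M) Z borel)"
        by (rule in_vimage_algebra)
      then show ?thesis by (simp add: vimage_def)
    qed
    then have "{(\<lambda>\<omega>. h (Z \<omega>)) -` A \<inter> space M |A. A \<in> sets borel}
        \<subseteq> sets (vimage_algebra (space M) Z borel)" by blast
    from sets.sigma_sets_subset[OF this] show ?thesis by simp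
  qed
  have indep: "indep_set (sets (vimage_algebra (space M) X borel)) (sets (vimage_algebra (space M) Y borel))"
    using ind by (simp add: indep_rv_def)
  note subX = sub[OF f, of X] and subY = sub[OF g, of Y]
  show ?thesis
    unfolding indep_var_eq
  proof (intro conjI indep_setI)
    show "random_variable borel (\<lambda>\<omega>. f (X \<omega>))" "random_variable borel (\<lambda>\<omega>. g (Y \<omega>))"
      using f g X Y by measurable
    show "sigma_sets (space M) {(\<lambda>\<omega>. f (X \<omega>)) -` A \<inter> space M |A. A \<in> sets borel} \<subseteq> events"
      using subX indep_setD_ev1[OF indep] by blast
    show "sigma_sets (space M) {(\<lambda>\<omega>. g (Y \<omega>)) -` A \<inter> space M |A. A \<in> sets borel} \<subseteq> events"
      using subY indep_setD_ev2[OF indep] by blast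
    fix a b assume "a \<in> sigma_sets (space M) {(\<lambda>\<omega>. f (X \<omega>)) -` A \<inter> space M |A. A \<in> sets borel}"
      "b \<in> sigma_sets (space M) {(\<lambda>\<omega>. g (Y \<omega>)) -` A \<inter> space M |A. A \<in> sets borel}"
    then show "prob (a \<inter> b) = prob a * prob b"
      using subX subY by (intro indep_setD[OF indep]) auto
  qed
qed

text \<open>The inner dimension of \<open>columnvector q ** rowvector q\<close> is an arbitrary type, so this product
  is a multiple of \<open>q q^T\<close>; the factor cancels in the quotient defining \<open>\<beta>\<close>.\<close>

lemma columnvector_mult_rowvector_nth:
  "(columnvector q ** (rowvector q :: real^'n^'b)) $ i $ j = CARD('b) * (q $ i * q $ j)"
  by (simp add: matrix_matrix_mult_def columnvector_def rowvector_def)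

text \<open>Entrywise, the form is a sum of products of an entry of \<open>G (Z \<omega>)\<close>
  with \<open>q \<omega> $ j * q \<omega> $ i\<close>; independence factors each expectation, and
  the second moments of \<open>q\<close> are the entries of \<open>R\<close>.\<close>

lemma (in prob_space) expectation_indep_quadratic_form:
  fixes Z :: "'a \<Rightarrow> 'b::topological_space" and q :: "'a \<Rightarrow> real^'n" and G :: "'b \<Rightarrow> real^'n^'n"
  assumes ind: "indep_rv M Z q" and Z: "Z \<in> borel_measurable M" and q: "q \<in> borel_measurable M"
    and R: "\<And>i j. has_bochner_integral M (\<lambda>\<omega>. q \<omega> $ i * q \<omega> $ j) (R $ i $ j)"
    and G: "G \<in> borel_measurable borel" and intG: "integrable M (\<lambda>\<omega>. G (Z \<omega>))"
  shows "integrable M (\<lambda>\<omega>. q \<omega> \<bullet> (G (Z \<omega>) *v q \<omega>))"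
    and "(\<integral>\<omega>. q \<omega> \<bullet> (G (Z \<omega>) *v q \<omega>) \<partial>M) = (\<integral>\<omega>. trace (R ** G (Z \<omega>)) \<partial>M)"
proof -
  have bl: "bounded_linear (\<lambda>C :: real^'n^'n. C $ i $ j)" for i j
    by (intro bounded_linear_compose[OF bounded_linear_vec_nth] bounded_linear_vec_nth)
  have nthm: "(\<lambda>C :: real^'n^'n. C $ i $ j) \<in> borel_measurable borel" for i j
    by (intro borel_measurable_continuous_onI continuous_intros)
  have qm: "(\<lambda>v :: real^'n. v $ i * v $ j) \<in> borel_measurable borel" for i j
    by (intro borel_measurable_continuous_onI continuous_intros)
  have iG: "integrable M (\<lambda>\<omega>. G (Z \<omega>) $ i $ j)" for i j
    by (rule integrable_bounded_linear[OF bl intG])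
  have indij: "indep_var borel (\<lambda>\<omega>. G (Z \<omega>) $ i $ j) borel (\<lambda>\<omega>. q \<omega> $ j * q \<omega> $ i)" for i j
    by (rule indep_rv_compose[OF ind Z q measurable_compose[OF G nthm] qm])
  have iq: "integrable M (\<lambda>\<omega>. q \<omega> $ j * q \<omega> $ i)" for i j using R by (rule integrable.intros)
  have prod: "integrable M (\<lambda>\<omega>. G (Z \<omega>) $ i $ j * (q \<omega> $ j * q \<omega> $ i))"
    "(\<integral>\<omega>. G (Z \<omega>) $ i $ j * (q \<omega> $ j * q \<omega> $ i) \<partial>M) = (\<integral>\<omega>. G (Z \<omega>) $ i $ j \<partial>M) * R $ j $ i" for i j
    using indep_var_integrable[OF indij iG iq] indep_var_lebesgue_integral[OF indij iG iq]
    by (simp_all add: has_bochner_integral_integral_eq[OF R])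
  have form: "q \<omega> \<bullet> (G (Z \<omega>) *v q \<omega>)
      = (\<Sum>i\<in>UNIV. \<Sum>j\<in>UNIV. G (Z \<omega>) $ i $ j * (q \<omega> $ j * q \<omega> $ i))" for \<omega>
    by (simp add: inner_vec_def matrix_vector_mult_def sum_distrib_left mult_ac)
  show "integrable M (\<lambda>\<omega>. q \<omega> \<bullet> (G (Z \<omega>) *v q \<omega>))"
    unfolding form by (intro Bochner_Integration.integrable_sum prod)
  have tr: "trace (R ** C) = (\<Sum>i\<in>UNIV. \<Sum>j\<in>UNIV. C $ i $ j * R $ j $ i)" for C :: "real^'n^'n"
    unfolding trace_mul_sym[of R] by (simp add: trace_def matrix_matrix_mult_def)
  show "(\<integral>\<omega>. q \<omega> \<bullet> (G (Z \<omega>) *v q \<omega>) \<partial>M) = (\<integral>\<omega>. trace (R ** G (Z \<omega>)) \<partial>M)"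
    unfolding form tr by (simp add: Bochner_Integration.integral_sum prod iG)
qed

text \<open>Splitting each \<open>matrix_inv A\<close> into two inverse roots regroups the product
  into \<open>k\<close> factors \<open>- rel_dev A Y\<close>, whose signs absorb
  \<open>(-1)^k\<close>.\<close>

lemma alternating_power_eq:
  assumes A: "pos_def A"
  shows "(-1)^k *\<^sub>R (matrix_inv A ** mat_power ((Y - A) ** matrix_inv A) k)
    = inv_sqrt A ** mat_power (rel_dev A Y) k ** inv_sqrt A"
proof (induction k)
  case 0
  then show ?case by (simp add: inv_sqrt_mult_self[OF A])
next
  case (Suc k)
  let ?H = "inv_sqrt A" and ?Z = "Y - A"
  have "(-1)^Suc k *\<^sub>R (matrix_inv A ** mat_power (?Z ** matrix_inv A) (Suc k))
      = - (?H ** ?H ** ?Z ** ((-1)^k *\<^sub>R (matrix_inv A ** mat_power (?Z ** matrix_inv A) k)))"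
    by (simp add: inv_sqrt_mult_self[OF A] matrix_mul_assoc matrix_mult.scaleR_right)
  also have "\<dots> = ?H ** mat_power (rel_dev A Y) (Suc k) ** ?H"
    unfolding Suc.IH by (simp add: rel_dev_def matrix_mul_assoc matrix_mult.minus_left matrix_mult.minus_right)
  finally show ?case .
qed

section \<open>Estimating the inverse\<close>

locale inverse_estimation = prob_space M
  for M :: "'w measure" +
  fixes A R :: "real^'n^'n" and Ahat :: "'w \<Rightarrow> real^'n^'n" and \<epsilon> :: real
  assumes A: "pos_def A"
    and Ahat_measurable: "Ahat \<in> borel_measurable M"
    and Ahat_pos: "AE \<omega> in M. pos_def (Ahat \<omega>)"
    and mean_le: "(\<integral>\<omega>. Ahat \<omega> \<partial>M) \<preceq> A"
    and inv_sq_integrable: "integrable M (\<lambda>\<omega>. mat_power (matrix_inv (Ahat \<omega>)) 2)"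
    and \<epsilon>: "\<epsilon> > 0"
    and Ahat_less: "AE \<omega> in M. Ahat \<omega> \<prec> (2 - \<epsilon>) *\<^sub>R A"
    and R0: "R \<noteq> 0" and R: "pos_semidef R"
begin

definition Y where "Y \<omega> = matrix_inv (Ahat \<omega>)"
definition X where "X \<omega> = rel_dev A (Ahat \<omega>)"
definition S where "S = conj_weight A R"
definition p where "p \<omega> k = trace (S ** mat_power (X \<omega>) k)"
definition m where "m k = exp_trace M S (\<lambda>\<omega>. mat_power (X \<omega>) k)"
definition s where "s = trace (R ** matrix_inv A)"
definition u where "u \<omega> = trace (R ** Y \<omega>)"
definition v where "v \<omega> = trace (R ** Y \<omega> ** A ** Y \<omega>)"

text \<open>Folding takes two rounds because \<open>p\<close>, \<open>u\<close> and \<open>v\<close>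
  are themselves expressed through \<open>S\<close>, \<open>X\<close> and \<open>Y\<close>.\<close>

lemmas facts = rel_dev_trace_facts[OF A R _ _ \<epsilon>, of "Ahat \<omega>" for \<omega>,
    folded S_def X_def Y_def s_def, folded p_def u_def v_def]

lemma AE_facts:
  "AE \<omega> in M. p \<omega> 0 = s" "AE \<omega> in M. 0 \<le> p \<omega> (2 * j)"
  "AE \<omega> in M. 0 \<le> p \<omega> (2*j) + 2 * p \<omega> (2*j+1) + p \<omega> (2*j+2)"
  "AE \<omega> in M. \<epsilon>^2 * s \<le> p \<omega> 0 + 2 * p \<omega> 1 + p \<omega> 2"
  "AE \<omega> in M. weighted_den (p \<omega>) \<longlonglongrightarrow> v \<omega>"
  "AE \<omega> in M. weighted_num (p \<omega>) \<longlonglongrightarrow> v \<omega> - u \<omega>"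
  "AE \<omega> in M. \<bar>weighted_den (p \<omega>) N\<bar> \<le> v \<omega>"
  "AE \<omega> in M. \<bar>weighted_num (p \<omega>) N\<bar> \<le> v \<omega> + s"
  "AE \<omega> in M. 0 \<le> u \<omega>" "AE \<omega> in M. s \<le> 4 * v \<omega>"
  "AE \<omega> in M. \<forall>i l. \<bar>mat_power (X \<omega>) k $ i $ l\<bar> \<le> CARD('n)"
  using Ahat_pos Ahat_less by (eventually_elim, use facts in blast)+

section \<open>Measurability and integrability of the traces\<close>

lemma X_measurable: "X \<in> borel_measurable M"
  unfolding X_def rel_dev_def
  by (intro borel_measurable_continuous_compose[OF _ Ahat_measurable]
      matrix_mult.continuous_on continuous_intros)

lemma Y_measurable: "Y \<in> borel_measurable M"
  unfolding Y_def by (rule measurable_compose[OF Ahat_measurable borel_measurable_matrix_inv])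

lemma integrable_power: "integrable M (\<lambda>\<omega>. mat_power (X \<omega>) k)"
proof (rule integrable_const_bound)
  show "AE \<omega> in M. norm (mat_power (X \<omega>) k) \<le> (\<Sum>i\<in>(UNIV::'n set). \<Sum>j\<in>(UNIV::'n set). real CARD('n))"
    using AE_facts(11)[of k]
  proof eventually_elim
    case (elim \<omega>)
    show ?case
      by (rule order_trans[OF norm_matrix_le_sum]) (intro sum_mono elim[rule_format])
  qed
  show "(\<lambda>\<omega>. mat_power (X \<omega>) k) \<in> borel_measurable M"
    by (intro borel_measurable_continuous_compose[OF _ X_measurable] continuous_intros)
qed

lemma bounded_linear_trace_mult: "bounded_linear (\<lambda>D. trace ((C :: real^'n^'n) ** D))"
  by (rule bounded_linear_compose[OF bounded_linear_trace matrix_mult.bounded_linear_right])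

lemma S: "pos_semidef S"
  unfolding S_def by (rule pos_semidef_conj_weight[OF A R])

lemma p_integrable: "integrable M (\<lambda>\<omega>. p \<omega> k)"
  unfolding p_def by (rule integrable_bounded_linear[OF bounded_linear_trace_mult integrable_power])

lemma m_eq: "m k = (\<integral>\<omega>. p \<omega> k \<partial>M)"
  by (simp add: m_def exp_trace_def p_def trace_mat_sqrt_conj[OF S])

lemma weighted_integrals:
  "integrable M (\<lambda>\<omega>. weighted_num (p \<omega>) N)" "(\<integral>\<omega>. weighted_num (p \<omega>) N \<partial>M) = weighted_num m N"
  "integrable M (\<lambda>\<omega>. weighted_den (p \<omega>) N)" "(\<integral>\<omega>. weighted_den (p \<omega>) N \<partial>M) = weighted_den m N"
  unfolding weighted_num_def weighted_den_def by (simp_all add: p_integrable m_eq)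

lemma Y_sym: "AE \<omega> in M. transpose (Y \<omega>) = Y \<omega>"
  using Ahat_pos by eventually_elim (metis Y_def pos_def_matrix_inv pos_def_def)

lemma Y_norm_sq_integrable: "integrable M (\<lambda>\<omega>. (norm (Y \<omega>))^2)"
proof (rule integrable_cong_AE_imp)
  show "integrable M (\<lambda>\<omega>. trace (mat_power (Y \<omega>) 2))"
    using integrable_bounded_linear[OF bounded_linear_trace inv_sq_integrable] by (simp add: Y_def)
  show "AE \<omega> in M. trace (mat_power (Y \<omega>) 2) = (norm (Y \<omega>))^2"
    using Y_sym by eventually_elim (rule norm_sq_symmetric[symmetric])
  show "(\<lambda>\<omega>. (norm (Y \<omega>))^2) \<in> borel_measurable M" using Y_measurable by measurable
qed

lemma Y_integrable: "integrable M Y"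
proof (rule Bochner_Integration.integrable_bound[where f = "\<lambda>\<omega>. 1 + (norm (Y \<omega>))^2"])
  show "integrable M (\<lambda>\<omega>. 1 + (norm (Y \<omega>))^2)" by (intro Bochner_Integration.integrable_add Y_norm_sq_integrable) simp
  have "norm y \<le> norm (1 + (norm y)^2)" for y :: "real^'n^'n"
  proof -
    \<comment> \<open>The square yields \<open>2 * norm y \<le> 1 + (norm y)^2\<close>, so square
      integrability gives integrability on a probability space.\<close>
    have "0 \<le> (norm y - 1)^2" by simp
    then have "2 * norm y \<le> 1 + (norm y)^2" by (simp add: power2_eq_square algebra_simps)
    then show ?thesis using norm_ge_zero[of y] by (simp del: norm_ge_zero)
  qed
  then show "AE \<omega> in M. norm (Y \<omega>) \<le> norm (1 + (norm (Y \<omega>))^2)" by blast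
qed (rule Y_measurable)

lemma u_integrable: "integrable M u"
  unfolding u_def by (rule integrable_bounded_linear[OF bounded_linear_trace_mult Y_integrable])

text \<open>\<open>v\<close> is quadratic in \<open>Y\<close>, hence dominated by a multiple of the
  squared norm.\<close>

lemma v_integrable: "integrable M v"
proof -
  have "bounded_bilinear (\<lambda>C D :: real^'n^'n. R ** C ** A ** D)"
    by (intro bounded_bilinear.comp1[OF bounded_bilinear_matrix_mult, of "\<lambda>C. R ** C ** A"]
        bounded_linear_compose[OF matrix_mult.bounded_linear_left] matrix_mult.bounded_linear_right)
  then obtain K where K: "\<And>C D :: real^'n^'n. norm (R ** C ** A ** D) \<le> norm C * norm D * K"
    using bounded_bilinear.bounded by blast
  obtain T where T: "0 \<le> T" "\<And>C :: real^'n^'n. \<bar>trace C\<bar> \<le> norm C * T"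
    using bounded_linear.nonneg_bounded[OF bounded_linear_trace] by (metis real_norm_def)
  have bound: "\<bar>v \<omega>\<bar> \<le> (norm (Y \<omega>))^2 * (K * T)" for \<omega>
  proof -
    have "\<bar>v \<omega>\<bar> \<le> norm (R ** Y \<omega> ** A ** Y \<omega>) * T" unfolding v_def by (rule T)
    also have "\<dots> \<le> (norm (Y \<omega>) * norm (Y \<omega>) * K) * T" by (intro mult_right_mono K T)
    finally show ?thesis by (simp add: power2_eq_square mult.assoc)
  qed
  show ?thesis
  proof (rule Bochner_Integration.integrable_bound)
    show "integrable M (\<lambda>\<omega>. (norm (Y \<omega>))^2 * (K * T))"
      by (intro integrable_mult_left Y_norm_sq_integrable)
    show "v \<in> borel_measurable M" unfolding v_def
      by (intro borel_measurable_continuous_compose[OF _ Y_measurable]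
          bounded_linear.continuous_on[OF bounded_linear_trace] matrix_mult.continuous_on continuous_intros)
    show "AE \<omega> in M. norm (v \<omega>) \<le> norm ((norm (Y \<omega>))^2 * (K * T))"
      by (intro AE_I2) (simp only: real_norm_def, rule order_trans[OF bound abs_ge_self])
  qed
qed

section \<open>The error as a quadratic in the scaling factor\<close>

definition a where "a = (\<integral>\<omega>. v \<omega> \<partial>M)"
definition b where "b = (\<integral>\<omega>. u \<omega> \<partial>M)"

lemma inv_error_scaled: "inv_error M A A R (\<lambda>\<omega>. c *\<^sub>R Y \<omega>) = c^2 * a - 2 * c * b + s"
proof -
  have "inv_error M A A R (\<lambda>\<omega>. c *\<^sub>R Y \<omega>) = (\<integral>\<omega>. c^2 * v \<omega> - 2 * c * u \<omega> + s \<partial>M)"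
    unfolding inv_error_def
  proof (rule integral_cong_AE)
    show "AE \<omega> in M. wnorm_sq A R (c *\<^sub>R Y \<omega> - matrix_inv A) = c^2 * v \<omega> - 2 * c * u \<omega> + s"
      using Y_sym by eventually_elim (simp add: wnorm_sq_scaled_inv[OF A R] u_def v_def s_def)
    show "(\<lambda>\<omega>. wnorm_sq A R (c *\<^sub>R Y \<omega> - matrix_inv A)) \<in> borel_measurable M"
      unfolding wnorm_sq_def
      by (intro borel_measurable_continuous_compose[OF _ Y_measurable]
          bounded_linear.continuous_on[OF bounded_linear_trace] matrix_mult.continuous_on
          continuous_on_transpose continuous_intros)
    show "(\<lambda>\<omega>. c^2 * v \<omega> - 2 * c * u \<omega> + s) \<in> borel_measurable M"
      using u_integrable v_integrable by measurable
  qed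
  also have "\<dots> = c^2 * a - 2 * c * b + s"
    by (simp add: u_integrable v_integrable a_def b_def prob_space)
  finally show ?thesis .
qed

lemma s_pos: "0 < s"
  unfolding s_def trace_mul_sym[of R] by (intro trace_mult_pos pos_def_matrix_inv A R R0)

lemma a_pos: "0 < a"
proof -
  have "(\<integral>\<omega>. s / 4 \<partial>M) \<le> a" unfolding a_def
    using AE_facts(10) by (intro integral_mono_AE v_integrable) auto
  then show ?thesis using s_pos by (simp add: prob_space)
qed

lemma b_nonneg: "0 \<le> b"
  unfolding b_def using AE_facts(9) by (rule integral_nonneg_AE)

section \<open>Signs of the expected moments and limits of the weighted sums\<close>

lemma m_nonneg: "0 \<le> m (2 * j)"
  unfolding m_eq using AE_facts(2) by (rule integral_nonneg_AE)

lemma m_0: "0 \<le> m 0" using m_nonneg[of 0] by simp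

lemma m_increment: "0 \<le> m (2*j) + 2 * m (2*j+1) + m (2*j+2)"
proof -
  have "0 \<le> (\<integral>\<omega>. p \<omega> (2*j) + 2 * p \<omega> (2*j+1) + p \<omega> (2*j+2) \<partial>M)"
    using AE_facts(3) by (rule integral_nonneg_AE)
  then show ?thesis by (simp add: m_eq p_integrable)
qed

text \<open>The hypothesis on the mean enters here: \<open>m 1\<close> is the trace of
  \<open>S\<close> times a conjugate of \<open>A\<close> minus the mean of
  \<open>Ahat\<close>.\<close>

lemma m_1: "0 \<le> m 1"
proof -
  let ?H = "inv_sqrt A" and ?Q = "mat_sqrt A"
  \<comment> \<open>Solving for \<open>Ahat\<close> makes it integrable along with \<open>X\<close>,
    so that the expectation can be moved inside the trace.\<close>
  have "Ahat \<omega> = A - ?Q ** X \<omega> ** ?Q" for \<omega>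
  proof -
    have "?Q ** X \<omega> ** ?Q = ?Q ** ?Q - (?Q ** ?H) ** Ahat \<omega> ** (?H ** ?Q)"
      by (simp add: X_def rel_dev_eq[OF A] matrix_mult.diff_left matrix_mult.diff_right matrix_mul_assoc)
    then show ?thesis
      by (simp add: inv_sqrt_props[OF A] mat_sqrt_mult_self pos_def_imp_semidef A)
  qed
  then have Ahat: "Ahat = (\<lambda>\<omega>. A - ?Q ** X \<omega> ** ?Q)" by blast
  have bl: "bounded_linear (\<lambda>C. D ** C ** E)" for D E :: "real^'n^'n"
    by (intro bounded_linear_compose[OF matrix_mult.bounded_linear_left] matrix_mult.bounded_linear_right)
  have "integrable M (\<lambda>\<omega>. ?Q ** X \<omega> ** ?Q)"
    using integrable_power[of 1] by (intro integrable_bounded_linear[OF bl]) simp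
  then have int: "integrable M Ahat"
    by (subst Ahat) (intro Bochner_Integration.integrable_diff, auto)
  have blt: "bounded_linear (\<lambda>C. trace (S ** (?H ** C ** ?H)))"
    by (rule bounded_linear_compose[OF bounded_linear_trace_mult bl])
  have "m 1 = (\<integral>\<omega>. trace (S ** (?H ** (A - Ahat \<omega>) ** ?H)) \<partial>M)"
    unfolding m_eq p_def X_def rel_dev_def
    by (simp add: matrix_mult.diff_left matrix_mult.diff_right)
  also have "\<dots> = trace (S ** (?H ** (\<integral>\<omega>. A - Ahat \<omega> \<partial>M) ** ?H))"
    by (intro integral_bounded_linear[OF blt] Bochner_Integration.integrable_diff int) simp
  also have "\<dots> = trace (S ** (?H ** (A - (\<integral>\<omega>. Ahat \<omega> \<partial>M)) ** ?H))"
    by (simp add: int prob_space)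
  also have "\<dots> \<ge> 0"
    using mean_le unfolding loewner_le_def
    by (intro trace_mult_nonneg S pos_semidef_conj transpose_inv_sqrt A)
  finally show ?thesis .
qed

text \<open>At index 1 the denominator is \<open>m 0 + 2 * m 1 + m 2\<close>, which is at least
  \<open>\<epsilon>^2 * s\<close>; afterwards it only grows.\<close>

lemma weighted_den_pos: "0 < weighted_den m (Suc N)"
proof (induction N)
  case 0
  have "(\<integral>\<omega>. \<epsilon>^2 * s \<partial>M) \<le> (\<integral>\<omega>. p \<omega> 0 + 2 * p \<omega> 1 + p \<omega> 2 \<partial>M)"
    using AE_facts(4) by (intro integral_mono_AE) (auto simp: p_integrable)
  then have "\<epsilon>^2 * s \<le> m 0 + 2 * m 1 + m 2" by (simp add: m_eq p_integrable prob_space)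
  moreover have "0 < \<epsilon>^2 * s" using \<epsilon> s_pos by simp
  ultimately show ?case by (simp add: weighted_den_Suc weighted_0 numeral_2_eq_2)
next
  case (Suc N)
  then show ?case using weighted_den_mono[of m "Suc N", OF m_0 m_increment] by simp
qed

lemma weighted_limits:
  "weighted_den m \<longlonglongrightarrow> a" "weighted_num m \<longlonglongrightarrow> a - b"
proof -
  have "(\<lambda>N. \<integral>\<omega>. weighted_den (p \<omega>) N \<partial>M) \<longlonglongrightarrow> (\<integral>\<omega>. v \<omega> \<partial>M)"
    using AE_facts(5,7) v_integrable weighted_integrals
    by (intro integral_dominated_convergence[where w = v]) auto
  then show "weighted_den m \<longlonglongrightarrow> a" by (simp add: weighted_integrals a_def)
  have "(\<lambda>N. \<integral>\<omega>. weighted_num (p \<omega>) N \<partial>M) \<longlonglongrightarrow> (\<integral>\<omega>. v \<omega> - u \<omega> \<partial>M)"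
    using AE_facts(6,8) v_integrable u_integrable weighted_integrals
    by (intro integral_dominated_convergence[where w = "\<lambda>\<omega>. v \<omega> + s"]) auto
  then show "weighted_num m \<longlonglongrightarrow> a - b"
    by (simp add: weighted_integrals a_def b_def u_integrable v_integrable)
qed

section \<open>The coefficients and the optimal coefficient\<close>

definition \<beta> where "\<beta> = beta_seq M A R Ahat"
definition \<beta>star where "\<beta>star = beta_opt M A R Ahat (\<lambda>\<omega>. matrix_inv (Ahat \<omega>))"

lemma \<beta>_eq: "\<beta> N = weighted_num m N / weighted_den m N"
  by (simp add: \<beta>_def beta_seq_def weighted_num_def weighted_den_def m_def S_def X_def)

text \<open>Completing the square exhibits the vertex \<open>1 - b / a\<close>.\<close>

lemma error_eq:
  "inv_error M A A R (\<lambda>\<omega>. (1 - x) *\<^sub>R matrix_inv (Ahat \<omega>)) = a * (x - (1 - b / a))^2 + (s - b^2 / a)"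
  using a_pos unfolding inv_error_scaled[unfolded Y_def]
  by (simp add: power2_eq_square field_simps)

text \<open>\<open>arg_min_on\<close> selects some minimiser by choice; its value is determined
  because \<open>a > 0\<close> makes the minimiser unique.\<close>

lemma \<beta>star_eq: "\<beta>star = 1 - b / a"
proof -
  let ?F = "\<lambda>x. inv_error M A A R (\<lambda>\<omega>. matrix_inv (Ahat \<omega>) - x *\<^sub>R matrix_inv (Ahat \<omega>))"
  have F: "?F x = a * (x - (1 - b / a))^2 + (s - b^2 / a)" for x
    using error_eq[of x] by (simp add: scaleR_diff_left)
  have "is_arg_min ?F (\<lambda>x. x \<in> UNIV) x \<longleftrightarrow> x = 1 - b / a" for x
  proof
    assume "is_arg_min ?F (\<lambda>x. x \<in> UNIV) x"
    then have "?F x \<le> ?F (1 - b / a)" by (simp add: is_arg_min_linorder)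
    then have "a * (x - (1 - b / a))^2 \<le> 0" unfolding F by simp
    then show "x = 1 - b / a" using a_pos by (simp add: mult_le_0_iff)
  next
    assume "x = 1 - b / a"
    then show "is_arg_min ?F (\<lambda>x. x \<in> UNIV) x"
      unfolding is_arg_min_linorder F using a_pos by simp
  qed
  then show ?thesis by (simp add: \<beta>star_def beta_opt_def arg_min_on_def arg_min_def)
qed

lemma \<beta>_tendsto: "\<beta> \<longlonglongrightarrow> \<beta>star"
proof -
  have "(\<lambda>N. weighted_num m N / weighted_den m N) \<longlonglongrightarrow> (a - b) / a"
    using weighted_limits a_pos by (intro tendsto_divide) auto
  then show ?thesis using a_pos by (simp add: \<beta>_eq[abs_def] \<beta>star_eq diff_divide_distrib)
qed

lemma \<beta>_mono: "1 \<le> N \<Longrightarrow> \<beta> N \<le> \<beta> (N + 1)"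
  using weighted_ratio_mono[of m N, OF m_0 m_increment] weighted_den_pos[of "N - 1"]
  by (simp add: \<beta>_eq)

lemma \<beta>_le_\<beta>star:
  assumes "1 \<le> N"
  shows "\<beta> N \<le> \<beta>star"
proof -
  \<comment> \<open>At index 0 the quotient has denominator 0 and monotonicity is known only from 1
    on, hence the shift by \<open>N\<close>.\<close>
  have "incseq (\<lambda>k. \<beta> (k + N))"
    using \<beta>_mono assms by (intro incseq_SucI) simp
  from incseq_le[OF this LIMSEQ_ignore_initial_segment[OF \<beta>_tendsto], of 0]
  show ?thesis by simp
qed

text \<open>For \<open>N = 1\<close> only \<open>m 1\<close>, nonnegative by the bound on the mean,
  and an even moment occur in the numerator.\<close>

lemma \<beta>_1_nonneg: "0 \<le> \<beta> 1"
proof -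
  have "weighted_num m 1 = m 1 + m 2 / 2"
    by (simp add: weighted_num_eq numeral_2_eq_2)
  then show ?thesis using m_1 m_nonneg[of 1] weighted_den_pos[of 0] by (simp add: \<beta>_eq)
qed

lemma \<beta>star_le_1: "\<beta>star \<le> 1"
  using a_pos b_nonneg by (simp add: \<beta>star_eq)

lemma error_antimono:
  assumes "x \<le> y" "y \<le> \<beta>star"
  shows "inv_error M A A R (\<lambda>\<omega>. (1 - y) *\<^sub>R matrix_inv (Ahat \<omega>))
    \<le> inv_error M A A R (\<lambda>\<omega>. (1 - x) *\<^sub>R matrix_inv (Ahat \<omega>))"
proof -
  have "(y - \<beta>star)^2 \<le> (x - \<beta>star)^2"
    using assms by (simp add: abs_le_square_iff[symmetric])
  then show ?thesis unfolding error_eq \<beta>star_eq[symmetric]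
    using a_pos by (simp add: mult_left_mono)
qed

section \<open>Sampling with an independent random vector\<close>

lemma sampled_integral:
  assumes q: "q \<in> borel_measurable M" and ind: "indep_rv M Ahat q"
    and qR: "has_bochner_integral M (\<lambda>\<omega>. columnvector (q \<omega>) ** (rowvector (q \<omega>) :: real^'n^'b)) R"
  shows "(\<integral>\<omega>. (\<Sum>k\<le>n. c k * (-1)^k *
           (q \<omega> \<bullet> ((matrix_inv A ** mat_power ((Ahat \<omega> - A) ** matrix_inv A) k) *v q \<omega>))) \<partial>M)
    = (\<Sum>k\<le>n. c k * m k) / CARD('b)"
proof -
  define G where "G k C = inv_sqrt A ** mat_power (rel_dev A C) k ** inv_sqrt A" for k C
  have eq: "c k * (-1)^k * (q \<omega> \<bullet> ((matrix_inv A ** mat_power ((Ahat \<omega> - A) ** matrix_inv A) k) *v q \<omega>))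
      = c k * (q \<omega> \<bullet> (G k (Ahat \<omega>) *v q \<omega>))" for k \<omega>
    unfolding G_def alternating_power_eq[OF A, symmetric]
    by (simp add: scaleR_matrix_vector_assoc[symmetric])
  have Gm: "G k \<in> borel_measurable borel" for k
    unfolding G_def rel_dev_def
    by (intro borel_measurable_continuous_onI matrix_mult.continuous_on continuous_intros)
  have bl: "bounded_linear (\<lambda>C. D ** C ** E)" for D E :: "real^'n^'n"
    by (intro bounded_linear_compose[OF matrix_mult.bounded_linear_left] matrix_mult.bounded_linear_right)
  have Gi: "integrable M (\<lambda>\<omega>. G k (Ahat \<omega>))" for k
    unfolding G_def X_def[symmetric] by (rule integrable_bounded_linear[OF bl integrable_power])
  \<comment> \<open>Division by \<open>CARD('b)\<close> undoes the multiplicity from the inner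
    dimension, so \<open>?R\<close> is the actual second moment matrix of \<open>q\<close>.\<close>
  let ?R = "(1 / CARD('b)) *\<^sub>R R"
  have "bounded_linear (\<lambda>C :: real^'n^'n. C $ i $ j / CARD('b))" for i j
    by (intro bounded_linear_divide bounded_linear_compose[OF bounded_linear_vec_nth] bounded_linear_vec_nth
        bounded_linear_compose[OF bounded_linear_divide])
  from has_bochner_integral_bounded_linear[OF this qR]
  have qq: "has_bochner_integral M (\<lambda>\<omega>. q \<omega> $ i * q \<omega> $ j) (?R $ i $ j)" for i j
    by (simp add: columnvector_mult_rowvector_nth)
  note form = expectation_indep_quadratic_form[OF ind Ahat_measurable q qq Gm Gi]
  have "(\<integral>\<omega>. trace (R ** G k (Ahat \<omega>)) \<partial>M) = m k" for k
    unfolding G_def m_eq p_def S_def trace_conj_weight_mult X_def ..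
  then have "(\<integral>\<omega>. trace (?R ** G k (Ahat \<omega>)) \<partial>M) = m k / CARD('b)" for k
    by (simp add: matrix_mult.scaleR_left trace_scaleR)
  then show ?thesis
    unfolding eq using form by (simp add: sum_divide_distrib)
qed

end

theorem theorem9p3:
  fixes M :: "'w measure"
    and A R :: "real^'n^'n"
    and Ahat :: "'w \<Rightarrow> real^'n^'n"
    and \<epsilon> :: real
  assumes "prob_space M"
    and "pos_def A"
    and "Ahat \<in> borel_measurable M"
    and "AE \<omega> in M. pos_def (Ahat \<omega>)"
    and "(\<integral>\<omega>. Ahat \<omega> \<partial>M) \<preceq> A"
    and "integrable M (\<lambda>\<omega>. mat_power (matrix_inv (Ahat \<omega>)) 2)"
    and "\<epsilon> > 0"
    and "AE \<omega> in M. 0 \<prec> Ahat \<omega> \<and> Ahat \<omega> \<prec> (2 - \<epsilon>) *\<^sub>R A"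
    and "R \<noteq> 0"
    and "pos_semidef R"
  defines "\<beta>star \<equiv> beta_opt M A R Ahat (\<lambda>\<omega>. matrix_inv (Ahat \<omega>))"
  defines "\<beta> \<equiv> beta_seq M A R Ahat"
  shows "(\<forall>qhat :: 'w \<Rightarrow> real^'n.
            qhat \<in> borel_measurable M \<and> indep_rv M Ahat qhat \<and>
            has_bochner_integral M (\<lambda>\<omega>. columnvector (qhat \<omega>) ** rowvector (qhat \<omega>)) R \<longrightarrow>
            (\<forall>N\<ge>1. \<beta> N =
              (\<integral>\<omega>. (\<Sum>k\<le>2*N. weight_num N k * (-1)^k *
                 (qhat \<omega> \<bullet> ((matrix_inv A ** mat_power ((Ahat \<omega> - A) ** matrix_inv A) k) *v qhat \<omega>))) \<partial>M) /
              (\<integral>\<omega>. (\<Sum>k\<le>2*N. weight_den N k * (-1)^k *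
                 (qhat \<omega> \<bullet> ((matrix_inv A ** mat_power ((Ahat \<omega> - A) ** matrix_inv A) k) *v qhat \<omega>))) \<partial>M)))
       \<and> \<beta> \<longlonglongrightarrow> \<beta>star
       \<and> 0 \<le> \<beta> 1 \<and> (\<forall>N\<ge>1. \<beta> N \<le> \<beta> (N + 1)) \<and> (\<forall>N\<ge>1. \<beta> N \<le> \<beta>star) \<and> \<beta>star \<le> 1
       \<and> inv_error M A A R (\<lambda>\<omega>. matrix_inv (Ahat \<omega>))
           \<ge> inv_error M A A R (\<lambda>\<omega>. (1 - \<beta> 1) *\<^sub>R matrix_inv (Ahat \<omega>))
       \<and> (\<forall>N\<ge>1. inv_error M A A R (\<lambda>\<omega>. (1 - \<beta> N) *\<^sub>R matrix_inv (Ahat \<omega>))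
                 \<ge> inv_error M A A R (\<lambda>\<omega>. (1 - \<beta> (N + 1)) *\<^sub>R matrix_inv (Ahat \<omega>)))
       \<and> (\<forall>N\<ge>1. inv_error M A A R (\<lambda>\<omega>. (1 - \<beta> N) *\<^sub>R matrix_inv (Ahat \<omega>))
                 \<ge> inv_error M A A R (\<lambda>\<omega>. (1 - \<beta>star) *\<^sub>R matrix_inv (Ahat \<omega>)))"
proof -
  interpret est: inverse_estimation M A R Ahat \<epsilon>
    using assms(1-10) by (auto simp: inverse_estimation_def inverse_estimation_axioms_def)
  have \<beta>: "\<beta> = est.\<beta>" and \<beta>star: "\<beta>star = est.\<beta>star"
    by (simp_all add: \<beta>_def est.\<beta>_def \<beta>star_def est.\<beta>star_def)
  show ?thesis
    unfolding \<beta> \<beta>star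
  proof (intro conjI allI impI, elim conjE, goal_cases)
    case (1 qhat N)
    \<comment> \<open>Numerator and denominator carry the same factor \<open>1 / CARD('b)\<close>,
      which cancels.\<close>
    show ?case
      unfolding est.sampled_integral[OF 1(2-4)] est.\<beta>_eq weighted_num_def weighted_den_def by simp
  next
    \<comment> \<open>The unscaled estimator is the case \<open>x = 0\<close> of
      \<open>error_antimono\<close>, compared with \<open>y = \<beta> 1\<close>.\<close>
    case 7
    show ?case
      using est.error_antimono[OF est.\<beta>_1_nonneg est.\<beta>_le_\<beta>star[OF order_refl]] by simp
  qed (assumption | rule est.\<beta>_tendsto est.\<beta>_1_nonneg est.\<beta>_mono est.\<beta>_le_\<beta>star est.\<beta>star_le_1
      est.error_antimono order_refl trans_le_add1)+
qed

end
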